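(* Let $A\in\mathbb{R}^{n\times n}$ be the inpainting matrix, $\mathbf{b}\in\mathbb{R}^n$ the vector of stored pixel values, and $\mathbf{b}_{\mathrm{sym}}=RA\mathbf{b}$, as defined in the context. Let $m\ge 2$ be an integer, $t>0$ and $\gamma>0$, and assume that the extended Krylov subspace $\mathcal{E}_m((\gamma I-tA)^{-1},\mathbf{b})$ has dimension $m$. Let $V_m\in\mathbb{R}^{n\times m}$ be a matrix whose columns form an orthonormal basis of this space with first column $\mathbf{b}/\|\mathbf{b}\|$, let $S_m=V_m^TAV_m$, and let $\mathbf{f}_m=\|\mathbf{b}\|\,V_m e^{tS_m}\mathbf{e}_1$ with $\mathbf{e}_1=(1,0,\dots,0)^T\in\mathbb{R}^m$. Then $$\|e^{tA}\mathbf{b}-\mathbf{f}_m\|\le 2t\,E_m(\gamma)\,\|\mathbf{b}_{\mathrm{sym}}\|,\qquad E_m(\gamma)=\min_{r\in\mathcal{R}_{m-1}}\ \sup_{z\in(-\infty,0]}|\varphi_1(z)-r(z)|,$$ where $\mathcal{R}_{m-1}=\left\{ z\mapsto \dfrac{p(z)}{(\gamma-z)^{m-2}} \;:\; p\in\mathcal{P}_{m-2}\right\}$ and $\mathcal{P}_{m-2}$ is the space of polynomials of degree at most $m-2$.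
   Context: Setting. Let $N_x,N_y\ge 1$ be integers and $n=N_xN_y$. The $n$ pixels of an $N_x\times N_y$ rectangular grid are numbered $1,\dots,n$ (row-major); two pixels are neighbours if they are horizontally or vertically adjacent, and $d_i$ is the number of neighbours of pixel $i$. Let $K\subseteq\{1,\dots,n\}$ be the set of stored pixels. The matrix $A\in\mathbb{R}^{n\times n}$ is defined as follows: for $i\in K$ the $i$-th row of $A$ is zero; for $i\notin K$, $A_{ii}=-d_i$, $A_{ij}=1$ if $j$ is a neighbour of $i$, and $A_{ij}=0$ otherwise. (This is the five-point Laplacian with grid constants one, homogeneous Neumann conditions at the picture boundary, and Dirichlet conditions at the stored pixels.) The vector $\mathbf{b}\in\mathbb{R}^n$ has $b_i=f_i$ for $i\in K$, where $f_i\in\mathbb{R}$ are given pixel values, and $b_i=0$ for $i\notin K$. The matrix $R\in\mathbb{R}^{(n-|K|)\times n}$ consists of the rows of the $n\times n$ identity matrix with indices not in $K$, in increasing order. Put $\mathbf{b}_{\mathrm{sym}}=RA\mathbf{b}$. $\|\cdot\|$ is the Euclidean norm. $\varphi_1(z)=(e^z-1)/z$ with $\varphi_1(0)=1$. The matrix $\gamma I-tA$ is invertible for $\gamma,t>0$, and $$\mathcal{E}_m((\gamma I-tA)^{-1},\mathbf{b})=\operatorname{span}\{\mathbf{b},A\mathbf{b},(\gamma I-tA)^{-1}\mathbf{b},\dots,(\gamma I-tA)^{-(m-2)}\mathbf{b}\}.$$ The vector $e^{tA}\mathbf{b}$ is the exact solution at time $t$ of $\mathbf{y}'=A\mathbf{y}$,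 $\mathbf{y}(0)=\mathbf{b}$. *)

theory Defs
  imports Complex_Main "HOL-Computational_Algebra.Polynomial"
    "Jordan_Normal_Form.VS_Connect" "Jordan_Normal_Form.Gauss_Jordan_Elimination"
begin

section \<open>The inpainting matrix\<close>

text \<open>
  Pixels and all vector and matrix indices are numbered from 0. In row-major order with rows of
  length \<open>Nx\<close>, pixel \<open>i\<close> lies in row \<open>i div Nx\<close> and column \<open>i mod Nx\<close>.
\<close>

definition neighbour :: "nat \<Rightarrow> nat \<Rightarrow> nat \<Rightarrow> bool" where
  "neighbour Nx i j \<longleftrightarrow>
     (i div Nx = j div Nx \<and> (i mod Nx = Suc (j mod Nx) \<or> j mod Nx = Suc (i mod Nx))) \<or>
     (i mod Nx = j mod Nx \<and> (i div Nx = Suc (j div Nx) \<or> j div Nx = Suc (i div Nx)))"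

definition num_neighbours :: "nat \<Rightarrow> nat \<Rightarrow> nat \<Rightarrow> nat" where
  "num_neighbours Nx Ny i = card {j. j < Nx * Ny \<and> neighbour Nx i j}"

definition inpainting_mat :: "nat \<Rightarrow> nat \<Rightarrow> nat set \<Rightarrow> real mat" where
  "inpainting_mat Nx Ny K = mat (Nx * Ny) (Nx * Ny)
     (\<lambda>(i, j). if i \<in> K then 0
               else if i = j then - real (num_neighbours Nx Ny i)
               else if neighbour Nx i j then 1 else 0)"

definition stored_vec :: "nat \<Rightarrow> nat set \<Rightarrow> (nat \<Rightarrow> real) \<Rightarrow> real vec" where
  "stored_vec n K f = vec n (\<lambda>i. if i \<in> K then f i else 0)"

definition restriction_mat :: "nat \<Rightarrow> nat set \<Rightarrow> real mat" where
  "restriction_mat n K = mat_of_rows n (map (row (1\<^sub>m n)) (filter (\<lambda>i. i \<notin> K) [0..<n]))"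


section \<open>Norm, inverse and exponential\<close>

definition eucl_norm :: "real vec \<Rightarrow> real" where
  "eucl_norm v = sqrt (v \<bullet> v)"

text \<open>Unspecified for singular matrices.\<close>

definition mat_inv :: "real mat \<Rightarrow> real mat" where
  "mat_inv M = the (mat_inverse M)"

definition mat_exp :: "real mat \<Rightarrow> real mat" where
  "mat_exp M = mat (dim_row M) (dim_row M) (\<lambda>(i, j). \<Sum>k. (M ^\<^sub>m k) $$ (i, j) / fact k)"

text \<open>The entrywise series always converges, so \<open>mat_exp\<close> is the usual matrix exponential.\<close>

lemma summable_mat_exp:
  assumes M: "M \<in> carrier_mat n n" and i: "i < n" and j: "j < n"
  shows "summable (\<lambda>k. (M ^\<^sub>m k) $$ (i, j) / fact k :: real)"
proof -
  define c where "c = (\<Sum>p\<in>{..<n} \<times> {..<n}. \<bar>M $$ p\<bar>)"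
  have c0: "c \<ge> 0"
    unfolding c_def by (rule sum_nonneg) simp
  have entry: "\<bar>M $$ (l, j)\<bar> \<le> c" if "l < n" "j < n" for l j
    unfolding c_def using that by (intro member_le_sum[of "(l, j)"]) auto
  have bound: "\<bar>(M ^\<^sub>m k) $$ (i, j)\<bar> \<le> (real n * c) ^ k" if "j < n" for j k
    using that
  proof (induction k arbitrary: j)
    case 0
    then show ?case using M i by simp
  next
    case (Suc k)
    have Mk: "M ^\<^sub>m k \<in> carrier_mat n n"
      using M by simp
    have "(M ^\<^sub>m Suc k) $$ (i, j) = (\<Sum>l = 0..<n. (M ^\<^sub>m k) $$ (i, l) * M $$ (l, j))"
      using M Mk i Suc.prems by (simp add: scalar_prod_def)
    also have "\<bar>\<dots>\<bar> \<le> (\<Sum>l = 0..<n. \<bar>(M ^\<^sub>m k) $$ (i, l)\<bar> * \<bar>M $$ (l, j)\<bar>)"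
      by (rule order_trans[OF sum_abs]) (simp add: abs_mult)
    also have "\<dots> \<le> (\<Sum>l = 0..<n. (real n * c) ^ k * c)"
      using Suc entry c0 by (intro sum_mono mult_mono) auto
    also have "\<dots> = (real n * c) ^ Suc k"
      by simp
    finally show ?case .
  qed
  show ?thesis
  proof (rule summable_comparison_test)
    show "\<exists>N. \<forall>k\<ge>N. norm ((M ^\<^sub>m k) $$ (i, j) / fact k) \<le> (real n * c) ^ k / fact k"
      using bound[OF j] by (auto intro!: divide_right_mono)
    show "summable (\<lambda>k. (real n * c) ^ k / fact k)"
      using summable_exp[of "real n * c"] by (simp add: divide_inverse mult.commute)
  qed
qed


section \<open>Extended Krylov subspaces\<close>

definition vec_span :: "nat \<Rightarrow> real vec set \<Rightarrow> real vec set" where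
  "vec_span n S = LinearCombinations.module.span class_ring (module_vec TYPE(real) n) S"

definition subspace_dim :: "nat \<Rightarrow> real vec set \<Rightarrow> nat" where
  "subspace_dim n W = vectorspace.dim class_ring (module_vec TYPE(real) n\<lparr>carrier := W\<rparr>)"

definition ext_krylov :: "real mat \<Rightarrow> real mat \<Rightarrow> real vec \<Rightarrow> nat \<Rightarrow> real vec set" where
  "ext_krylov A C b m =
     vec_span (dim_vec b) ({b, A *\<^sub>v b} \<union> (\<lambda>k. (C ^\<^sub>m k) *\<^sub>v b) ` {1..m - 2})"


section \<open>Rational best approximation\<close>

definition phi1 :: "real \<Rightarrow> real" where
  "phi1 z = (if z = 0 then 1 else (exp z - 1) / z)"

definition rat_funs :: "real \<Rightarrow> nat \<Rightarrow> (real \<Rightarrow> real) set" where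
  "rat_funs \<gamma> d = {\<lambda>z. poly p z / (\<gamma> - z) ^ d | p. degree p \<le> d}"

definition sup_error :: "(real \<Rightarrow> real) \<Rightarrow> real" where
  "sup_error r = (SUP z\<in>{..0}. \<bar>phi1 z - r z\<bar>)"

definition best_error :: "real \<Rightarrow> nat \<Rightarrow> real" where
  "best_error \<gamma> m = (INF r\<in>rat_funs \<gamma> (m - 2). sup_error r)"

text \<open>The supremum is taken over a bounded set.\<close>

lemma bdd_above_error:
  assumes \<gamma>: "\<gamma> > 0" and r: "r \<in> rat_funs \<gamma> d"
  shows "bdd_above ((\<lambda>z. \<bar>phi1 z - r z\<bar>) ` {..0})"
proof -
  obtain p where p: "degree p \<le> d" and r_eq: "r = (\<lambda>z. poly p z / (\<gamma> - z) ^ d)"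
    using r by (auto simp: rat_funs_def)
  define B where "B = (\<Sum>i\<le>degree p. \<bar>coeff p i\<bar> / \<gamma> ^ (d - i))"
  have phi: "\<bar>phi1 z\<bar> \<le> 1" if "z \<le> 0" for z
  proof (cases "z = 0")
    case False
    then have "z < 0" using that by simp
    moreover have "z \<le> exp z - 1" "exp z - 1 \<le> 0"
      using exp_ge_add_one_self[of z] that by (linarith, simp)
    ultimately show ?thesis
      by (simp add: phi1_def divide_simps)
  qed (simp add: phi1_def)
  have rat: "\<bar>r z\<bar> \<le> B" if z: "z \<le> 0" for z
  proof -
    have pos: "\<gamma> - z > 0" using z \<gamma> by simp
    have "\<bar>r z\<bar> = \<bar>\<Sum>i\<le>degree p. coeff p i * z ^ i / (\<gamma> - z) ^ d\<bar>"
      unfolding r_eq poly_altdef by (simp add: sum_divide_distrib)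
    also have "\<dots> \<le> (\<Sum>i\<le>degree p. \<bar>coeff p i * z ^ i / (\<gamma> - z) ^ d\<bar>)"
      by (rule sum_abs)
    also have "\<dots> \<le> B"
      unfolding B_def
    proof (rule sum_mono)
      fix i assume "i \<in> {..degree p}"
      then have "i \<le> d" using p by simp
      then have split: "(\<gamma> - z) ^ d = (\<gamma> - z) ^ (d - i) * (\<gamma> - z) ^ i"
        by (simp flip: power_add)
      have "\<bar>z\<bar> ^ i / (\<gamma> - z) ^ i \<le> 1"
        using z \<gamma> pos by (simp add: power_mono)
      moreover have "1 / (\<gamma> - z) ^ (d - i) \<le> 1 / \<gamma> ^ (d - i)"
        using z \<gamma> by (intro divide_left_mono power_mono mult_pos_pos) auto
      ultimately have "1 / (\<gamma> - z) ^ (d - i) * (\<bar>z\<bar> ^ i / (\<gamma> - z) ^ i) \<le> 1 / \<gamma> ^ (d - i) * 1"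
        using pos \<gamma> by (intro mult_mono) auto
      then have "\<bar>coeff p i\<bar> * (\<bar>z\<bar> ^ i / (\<gamma> - z) ^ d) \<le> \<bar>coeff p i\<bar> * (1 / \<gamma> ^ (d - i))"
        unfolding split by (intro mult_left_mono) auto
      then show "\<bar>coeff p i * z ^ i / (\<gamma> - z) ^ d\<bar> \<le> \<bar>coeff p i\<bar> / \<gamma> ^ (d - i)"
        using pos by (simp add: abs_mult power_abs)
    qed
    finally show ?thesis .
  qed
  show ?thesis
  proof (rule bdd_aboveI2)
    fix z :: real assume "z \<in> {..0}"
    then show "\<bar>phi1 z - r z\<bar> \<le> 1 + B"
      using phi[of z] rat[of z] by auto
  qed
qed

end

theory Submission
  imports Defs "HOL-Analysis.L2_Norm" "HOL-Computational_Algebra.Fundamental_Theorem_Algebra"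
begin

text \<open>
  Let \<open>u = A b\<close> and let \<open>H\<close> be \<open>A\<close> with the columns of stored pixels set to zero. As \<open>u\<close> vanishes on \<open>K\<close>,
  where all rows of \<open>A\<close> are zero, \<open>e\<^bsup>tA\<^esup> b = b + t \<phi>\<^sub>1(tH) u\<close> with \<open>H\<close> symmetric and negative semidefinite.
  The first column of \<open>V\<close> is parallel to \<open>b\<close> and the others are orthogonal to it, hence vanish on \<open>K\<close>, so
  likewise \<open>f\<^sub>m = b + t V \<phi>\<^sub>1(tV\<^sup>THV) V\<^sup>T u\<close>. The Krylov space contains \<open>(\<gamma> - tH)\<^sup>-\<^sup>k u\<close> for \<open>k \<le> m - 2\<close>, and
  therefore \<open>r(tH) u = V r(tV\<^sup>THV) V\<^sup>T u\<close> for every \<open>r = p / (\<gamma> - z)\<^bsup>m-2\<^esup>\<close> with \<open>deg p \<le> m - 2\<close>.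
  Subtracting this leaves \<open>(\<phi>\<^sub>1 - r)(tH)\<close> and \<open>(\<phi>\<^sub>1 - r)(tV\<^sup>THV)\<close>, and by the spectral theorem each of them
  has norm at most \<open>sup |\<phi>\<^sub>1 - r|\<close> over \<open>z \<le> 0\<close>.
\<close>

section \<open>Vectors and powers of matrices\<close>

lemma index_mult_mat_vec_sum:
  assumes "H \<in> carrier_mat m n" "v \<in> carrier_vec n" "i < m"
  shows "(H *\<^sub>v v) $ i = (\<Sum>j<n. H $$ (i, j) * v $ j)"
  using assms by (auto simp: scalar_prod_def atLeast0LessThan)

lemma smult_mat_mult_vec:
  assumes "H \<in> carrier_mat m n" "v \<in> carrier_vec n"
  shows "(c \<cdot>\<^sub>m H) *\<^sub>v v = (c :: real) \<cdot>\<^sub>v (H *\<^sub>v v)"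
  using assms by (intro eq_vecI) auto

lemma scalar_prod_self_nonneg: "(v :: real vec) \<bullet> v \<ge> 0"
  by (simp add: scalar_prod_def sum_nonneg)

lemma scalar_prod_self_eq_0D: "v = 0\<^sub>v n" if "v \<in> carrier_vec n" "v \<bullet> v = (0 :: real)"
  using that by (auto simp: scalar_prod_def sum_nonneg_eq_0_iff)

lemma eucl_norm_nonneg: "eucl_norm v \<ge> 0"
  by (simp add: eucl_norm_def scalar_prod_self_nonneg)

lemma eucl_norm_le_iff: "eucl_norm v \<le> e \<longleftrightarrow> v \<bullet> v \<le> e\<^sup>2" if "e \<ge> 0"
  using that unfolding eucl_norm_def by (metis real_sqrt_le_iff real_sqrt_abs abs_of_nonneg)

lemma eucl_norm_eq_L2_set:
  assumes "v \<in> carrier_vec n"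
  shows "eucl_norm v = L2_set (\<lambda>i. v $ i) {..<n}"
  using assms by (simp add: eucl_norm_def L2_set_def scalar_prod_def power2_eq_square atLeast0LessThan)

lemma eucl_norm_diff_le:
  assumes "v \<in> carrier_vec n" "w \<in> carrier_vec n"
  shows "eucl_norm (v - w) \<le> eucl_norm v + eucl_norm w"
proof -
  have "eucl_norm (v - w) = L2_set (\<lambda>i. v $ i + - w $ i) {..<n}"
    using assms by (subst eucl_norm_eq_L2_set[of _ n]) (auto intro!: L2_set_cong)
  also have "\<dots> \<le> L2_set (\<lambda>i. v $ i) {..<n} + L2_set (\<lambda>i. - w $ i) {..<n}"
    by (rule L2_set_triangle_ineq)
  also have "L2_set (\<lambda>i. - w $ i) {..<n} = L2_set (\<lambda>i. w $ i) {..<n}"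
    by (simp add: L2_set_def)
  finally show ?thesis
    using assms by (simp add: eucl_norm_eq_L2_set)
qed

lemma eucl_norm_smult: "eucl_norm (c \<cdot>\<^sub>v v) = \<bar>c\<bar> * eucl_norm v"
proof -
  have "(c \<cdot>\<^sub>v v) \<bullet> (c \<cdot>\<^sub>v v) = c\<^sup>2 * (v \<bullet> v)"
    by (simp add: scalar_prod_smult_left scalar_prod_smult_right power2_eq_square)
  then show ?thesis
    by (simp add: eucl_norm_def real_sqrt_mult)
qed

lemma pow_mat_mult_vec_Suc:
  assumes "H \<in> carrier_mat n n" "v \<in> carrier_vec n"
  shows "(H ^\<^sub>m Suc k) *\<^sub>v v = (H ^\<^sub>m k) *\<^sub>v (H *\<^sub>v (v :: real vec))"
  using assms by (simp add: assoc_mult_mat_vec[of _ n n _ n])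

lemma pow_mat_mult_vec_Suc':
  assumes "H \<in> carrier_mat n n" "v \<in> carrier_vec n"
  shows "(H ^\<^sub>m Suc k) *\<^sub>v v = H *\<^sub>v ((H ^\<^sub>m k) *\<^sub>v (v :: real vec))"
  using assms(2)
proof (induction k arbitrary: v)
  case 0
  then show ?case using assms(1) by simp
next
  case (Suc k)
  then show ?case
    using assms(1) by (simp only: pow_mat_mult_vec_Suc[of H n] mult_mat_vec_carrier)
qed

lemma pow_mat_mult_eigenvector:
  assumes "H \<in> carrier_mat n n" "w \<in> carrier_vec n" "H *\<^sub>v w = c \<cdot>\<^sub>v (w :: real vec)"
  shows "(H ^\<^sub>m k) *\<^sub>v w = c ^ k \<cdot>\<^sub>v w"
proof (induction k)
  case 0
  then show ?case using assms by simp
next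
  case (Suc k)
  then show ?case
    using assms by (simp add: pow_mat_mult_vec_Suc'[of _ n] mult_mat_vec[of _ n n] smult_smult_assoc
      mult.commute del: pow_mat.simps)
qed

lemma symmetric_scalar_prod:
  assumes "H \<in> carrier_mat n n" "transpose_mat H = H" "x \<in> carrier_vec n" "y \<in> carrier_vec n"
  shows "(H *\<^sub>v x) \<bullet> y = x \<bullet> (H *\<^sub>v (y :: real vec))"
  using transpose_vec_mult_scalar[of H n n y x] assms by simp


section \<open>Polynomials of a matrix applied to a vector\<close>

text \<open>This is \<open>p(H) v\<close> by the Horner scheme. Acting on a vector from the start
  avoids forming the matrix \<open>p(H)\<close>.\<close>

definition poly_app :: "real mat \<Rightarrow> real poly \<Rightarrow> real vec \<Rightarrow> real vec" where
  "poly_app H p v = fold_coeffs (\<lambda>a w. a \<cdot>\<^sub>v v + H *\<^sub>v w) p (0\<^sub>v (dim_vec v))"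

context
  fixes H :: "real mat" and n :: nat
  assumes H: "H \<in> carrier_mat n n"
begin

lemma poly_app_0: "v \<in> carrier_vec n \<Longrightarrow> poly_app H 0 v = 0\<^sub>v n"
  by (simp add: poly_app_def)

lemma mult_mat_zero_vec: "H *\<^sub>v 0\<^sub>v n = 0\<^sub>v n"
  using H by (intro eq_vecI) auto

lemma poly_app_pCons:
  assumes "v \<in> carrier_vec n"
  shows "poly_app H (pCons a p) v = a \<cdot>\<^sub>v v + H *\<^sub>v poly_app H p v"
proof (cases "a = 0 \<and> p = 0")
  \<comment> \<open>The coefficient list of \<open>pCons 0 0\<close> is empty, so
    \<open>fold_coeffs\<close> takes no extra step here; the right-hand side is then zero as
    well.\<close>
  case True
  have "0 \<cdot>\<^sub>v v + 0\<^sub>v n = 0\<^sub>v n"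
    using assms by (intro eq_vecI) auto
  then show ?thesis
    using assms True by (simp add: poly_app_def mult_mat_zero_vec)
next
  case False
  then show ?thesis
    by (auto simp: poly_app_def fold_coeffs_def cCons_def)
qed

lemma poly_app_carrier: "v \<in> carrier_vec n \<Longrightarrow> poly_app H p v \<in> carrier_vec n"
  by (induction p) (use H in \<open>auto simp: poly_app_0 poly_app_pCons\<close>)

lemma poly_app_const: "v \<in> carrier_vec n \<Longrightarrow> poly_app H [:a:] v = a \<cdot>\<^sub>v v"
  by (simp add: poly_app_pCons poly_app_0 mult_mat_zero_vec)

lemma poly_app_add:
  assumes v: "v \<in> carrier_vec n"
  shows "poly_app H (p + q) v = poly_app H p v + poly_app H q v"
proof (induction p q rule: poly_induct2)
  case 0
  then show ?case using v by (simp add: poly_app_0)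
next
  case (pCons a p b q)
  have "H *\<^sub>v poly_app H (p + q) v = H *\<^sub>v poly_app H p v + H *\<^sub>v poly_app H q v"
    unfolding pCons using H v by (intro mult_add_distrib_mat_vec) (auto intro: poly_app_carrier)
  then show ?case
    using H v poly_app_carrier[OF v]
    by (intro eq_vecI) (auto simp: poly_app_pCons algebra_simps simp del: index_mult_mat_vec)
qed

lemma poly_app_smult:
  assumes v: "v \<in> carrier_vec n"
  shows "poly_app H (smult c p) v = c \<cdot>\<^sub>v poly_app H p v"
proof (induction p)
  case 0
  then show ?case using v by (auto simp: poly_app_0 intro!: eq_vecI)
next
  case (pCons a p)
  have "H *\<^sub>v poly_app H (smult c p) v = c \<cdot>\<^sub>v (H *\<^sub>v poly_app H p v)"
    unfolding pCons using H v by (intro mult_mat_vec) (auto intro: poly_app_carrier)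
  then show ?case
    using H v poly_app_carrier[OF v]
    by (intro eq_vecI) (auto simp: poly_app_pCons algebra_simps simp del: index_mult_mat_vec)
qed

lemma poly_app_mult:
  assumes v: "v \<in> carrier_vec n"
  shows "poly_app H (p * q) v = poly_app H p (poly_app H q v)"
proof (induction p)
  case 0
  then show ?case using v by (simp add: poly_app_0 poly_app_carrier)
next
  case (pCons a p)
  then show ?case
    using H v by (simp add: poly_app_add poly_app_smult poly_app_pCons poly_app_carrier)
      (intro eq_vecI, auto simp: poly_app_carrier carrier_vecD[OF poly_app_carrier])
qed

text \<open>Linearity in the vector is stated for \<open>c v - w\<close> because this combination
  occurs twice: when an eigenvector is split off, and in the recurrence satisfied by the shifted
  inverse iterates.\<close>

lemma poly_app_diff_smult_vec:
  assumes v: "v \<in> carrier_vec n" and w: "w \<in> carrier_vec n"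
  shows "poly_app H p (c \<cdot>\<^sub>v v - w) = c \<cdot>\<^sub>v poly_app H p v - poly_app H p w"
proof (induction p)
  case 0
  then show ?case using v w by (auto simp: poly_app_0 intro!: eq_vecI)
next
  case (pCons a p)
  have "H *\<^sub>v (c \<cdot>\<^sub>v poly_app H p v - poly_app H p w) =
      c \<cdot>\<^sub>v (H *\<^sub>v poly_app H p v) - H *\<^sub>v poly_app H p w"
    using H v w by (subst mult_minus_distrib_mat_vec[of _ n n])
      (auto simp: mult_mat_vec[of _ n n] poly_app_carrier)
  moreover have "c \<cdot>\<^sub>v v - w \<in> carrier_vec n"
    using v w by simp
  ultimately show ?case
    using H v w pCons
    by (simp add: poly_app_pCons)
      (intro eq_vecI, auto simp: algebra_simps simp del: index_mult_mat_vec)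
qed

lemma poly_app_monom:
  assumes v: "v \<in> carrier_vec n"
  shows "poly_app H (monom c k) v = c \<cdot>\<^sub>v ((H ^\<^sub>m k) *\<^sub>v v)"
proof (induction k)
  case 0
  then show ?case using H v by (simp add: monom_0 poly_app_const)
next
  case (Suc k)
  have "poly_app H (monom c (Suc k)) v = 0 \<cdot>\<^sub>v v + H *\<^sub>v (c \<cdot>\<^sub>v ((H ^\<^sub>m k) *\<^sub>v v))"
    using v Suc by (simp add: monom_Suc poly_app_pCons)
  also have "\<dots> = c \<cdot>\<^sub>v (H *\<^sub>v ((H ^\<^sub>m k) *\<^sub>v v))"
    using H v by (subst mult_mat_vec[of _ n n])
      (auto simp: pow_carrier_mat intro!: mult_mat_vec_carrier)
  also have "\<dots> = c \<cdot>\<^sub>v ((H ^\<^sub>m Suc k) *\<^sub>v v)"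
    using H v by (simp add: pow_mat_mult_vec_Suc'[of _ n] del: pow_mat.simps)
  finally show ?case .
qed

lemma index_poly_app_sum:
  assumes v: "v \<in> carrier_vec n" and i: "i < n" and J: "finite J"
  shows "poly_app H (\<Sum>j\<in>J. p j) v $ i = (\<Sum>j\<in>J. poly_app H (p j) v $ i)"
  using J
proof (induction J)
  case empty
  then show ?case using v i by (simp add: poly_app_0)
next
  case (insert j J)
  then show ?case using v i by (simp add: poly_app_add carrier_vecD[OF poly_app_carrier])
qed

lemma poly_app_eigenvector:
  assumes w: "w \<in> carrier_vec n" and ev: "H *\<^sub>v w = c \<cdot>\<^sub>v w"
  shows "poly_app H p w = poly p c \<cdot>\<^sub>v w"
proof (induction p)
  case 0
  then show ?case using w by (auto simp: poly_app_0 intro!: eq_vecI)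
next
  case (pCons a p)
  then show ?case
    using H w ev by (simp add: poly_app_pCons mult_mat_vec[of _ n n] smult_smult_assoc
      add_smult_distrib_vec mult.commute)
qed

text \<open>
  The vectors \<open>H\<^sup>0 v, \<dots>, H\<^sup>n v\<close> form the columns of a singular matrix once a zero row is appended.
\<close>

lemma annihilating_poly_exists:
  assumes v: "v \<in> carrier_vec n"
  obtains p where "p \<noteq> 0" "poly_app H p v = 0\<^sub>v n"
proof -
  define M where "M = mat (Suc n) (Suc n) (\<lambda>(i, j). if i < n then ((H ^\<^sub>m j) *\<^sub>v v) $ i else 0)"
  have M: "M \<in> carrier_mat (Suc n) (Suc n)"
    by (simp add: M_def)
  \<comment> \<open>The zero row of \<open>M\<close> is a zero column of the transpose, which
    therefore kills the last unit vector; the determinant carries singularity back to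
    \<open>M\<close>.\<close>
  have "transpose_mat M *\<^sub>v unit_vec (Suc n) n = 0\<^sub>v (Suc n)"
    by (intro eq_vecI) (auto simp: M_def)
  moreover have "unit_vec (Suc n) n \<noteq> (0\<^sub>v (Suc n) :: real vec)"
    by (simp add: unit_vec_nonzero)
  ultimately have "det (transpose_mat M) = 0"
    using M by (subst det_0_iff_vec_prod_zero[of _ "Suc n"]) (auto intro!: exI[of _ "unit_vec (Suc n) n"])
  then have "det M = 0"
    using M by (simp add: det_transpose)
  then obtain c where c: "c \<in> carrier_vec (Suc n)" "c \<noteq> 0\<^sub>v (Suc n)" "M *\<^sub>v c = 0\<^sub>v (Suc n)"
    using M by (auto simp: det_0_iff_vec_prod_zero[of _ "Suc n"])
  define p where "p = (\<Sum>j\<in>{..<Suc n}. monom (c $ j) j)"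
  have "p \<noteq> 0"
  proof
    assume "p = 0"
    have "c $ i = 0" if "i < Suc n" for i
    proof -
      have "coeff p i = (\<Sum>j\<in>{..<Suc n}. if j = i then c $ j else 0)"
        by (simp add: p_def coeff_sum)
      also have "\<dots> = c $ i"
        using that by (simp add: sum.delta del: lessThan_Suc)
      finally show ?thesis using \<open>p = 0\<close> by simp
    qed
    then have "c = 0\<^sub>v (Suc n)"
      using c(1) by (intro eq_vecI) auto
    then show False using c(2) by simp
  qed
  moreover have "poly_app H p v = 0\<^sub>v n"
  proof (rule eq_vecI)
    fix i assume "i < dim_vec (0\<^sub>v n :: real vec)"
    then have i: "i < n" by simp
    have "poly_app H p v $ i = (\<Sum>j<Suc n. c $ j * ((H ^\<^sub>m j) *\<^sub>v v) $ i)"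
      unfolding p_def using v i H
      by (subst index_poly_app_sum) (auto simp: poly_app_monom pow_mat_dim_square simp del: index_mult_mat_vec sum.lessThan_Suc)
    also have "\<dots> = (\<Sum>j<Suc n. M $$ (i, j) * c $ j)"
      using i by (intro sum.cong) (auto simp: M_def)
    also have "\<dots> = (M *\<^sub>v c) $ i"
      using i by (intro index_mult_mat_vec_sum[OF M c(1), symmetric]) simp
    finally show "poly_app H p v $ i = 0\<^sub>v n $ i"
      using c(3) i by simp
  qed (use poly_app_carrier[OF v] in simp)
  ultimately show ?thesis using that by blast
qed

end

section \<open>Spectral decomposition of symmetric matrices\<close>

lemma poly_map_poly_of_real:
  "poly (map_poly of_real p) (of_real x) = (of_real (poly p x) :: complex)"
  by (induction p) (auto simp: map_poly_pCons)

lemma map_poly_of_real_mult_add: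
  "map_poly complex_of_real (p * q + r) = map_poly of_real p * map_poly of_real q + map_poly of_real r"
  by (intro poly_eqI) (simp add: coeff_map_poly coeff_mult)

context
  fixes H :: "real mat" and n :: nat
  assumes H: "H \<in> carrier_mat n n" and sym: "transpose_mat H = H"
begin

lemma poly_app_linear_factor:
  assumes "v \<in> carrier_vec n"
  shows "poly_app H [:- a, 1:] v = H *\<^sub>v v - a \<cdot>\<^sub>v v"
  using assms H
  by (simp add: poly_app_pCons[OF H] poly_app_const[OF H] poly_app_0[OF H] mult_mat_zero_vec[OF H])
    (intro eq_vecI, auto)

text \<open>Moving a factor \<open>H - a\<close> across the scalar product is the only way in which
  the symmetry of \<open>H\<close> enters the removal of double and non-real roots.\<close>

lemma poly_app_linear_factor_symmetric:
  assumes x: "x \<in> carrier_vec n" and y: "y \<in> carrier_vec n"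
  shows "poly_app H [:- a, 1:] x \<bullet> y = x \<bullet> poly_app H [:- a, 1:] y"
  using H x y symmetric_scalar_prod[OF H sym x y]
  by (simp add: poly_app_linear_factor minus_scalar_prod_distrib[of _ n] scalar_prod_minus_distrib[of _ n])

text \<open>The eigenvalues themselves index the summands, so different summands belong to different
  eigenvalues and are orthogonal without further choice. A summand may be zero. Equality is stated
  entrywise to stay with sums of reals.\<close>

definition eigen_sum :: "real vec \<Rightarrow> bool" where
  "eigen_sum v \<longleftrightarrow> (\<exists>\<Lambda> w. finite \<Lambda> \<and> (\<forall>c\<in>\<Lambda>. w c \<in> carrier_vec n \<and> H *\<^sub>v w c = c \<cdot>\<^sub>v w c) \<and>
     (\<forall>i<n. v $ i = (\<Sum>c\<in>\<Lambda>. w c $ i)))"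

lemma eigen_sum_add:
  assumes "eigen_sum v" and y: "y \<in> carrier_vec n" "H *\<^sub>v y = a \<cdot>\<^sub>v y"
    and eq: "\<And>i. i < n \<Longrightarrow> v' $ i = v $ i + y $ i"
  shows "eigen_sum v'"
proof -
  obtain \<Lambda> w where fin: "finite \<Lambda>" and w: "\<And>c. c \<in> \<Lambda> \<Longrightarrow> w c \<in> carrier_vec n"
    and ev: "\<And>c. c \<in> \<Lambda> \<Longrightarrow> H *\<^sub>v w c = c \<cdot>\<^sub>v w c" and v: "\<And>i. i < n \<Longrightarrow> v $ i = (\<Sum>c\<in>\<Lambda>. w c $ i)"
    using assms(1) unfolding eigen_sum_def by blast
  \<comment> \<open>If \<open>a\<close> already occurs, the new eigenvector is merged into its
    summand, which keeps one summand per eigenvalue.\<close>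
  define w' where "w' = w(a := (if a \<in> \<Lambda> then w a + y else y))"
  have "H *\<^sub>v (w a + y) = a \<cdot>\<^sub>v (w a + y)" if "a \<in> \<Lambda>"
    using that w[OF that] ev[OF that] y H by (simp add: mult_add_distrib_mat_vec[of _ n n] smult_add_distrib_vec)
  then have "\<forall>c\<in>insert a \<Lambda>. w' c \<in> carrier_vec n \<and> H *\<^sub>v w' c = c \<cdot>\<^sub>v w' c"
    using w ev y by (auto simp: w'_def)
  moreover have "v' $ i = (\<Sum>c\<in>insert a \<Lambda>. w' c $ i)" if i: "i < n" for i
  proof -
    have "(\<Sum>c\<in>\<Lambda> - {a}. w' c $ i) = (\<Sum>c\<in>\<Lambda> - {a}. w c $ i)"
      by (intro sum.cong) (auto simp: w'_def)
    then show ?thesis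
      using fin i eq[OF i] v[OF i] y(1) w
      by (cases "a \<in> \<Lambda>") (auto simp: sum.insert_remove sum.remove w'_def)
  qed
  ultimately show ?thesis
    unfolding eigen_sum_def using fin by (intro exI[of _ "insert a \<Lambda>"] exI[of _ w']) auto
qed

text \<open>
  Induction on the degree of a polynomial annihilating \<open>v\<close>: symmetry of \<open>H\<close> allows to discard
  double and non-real roots, and a simple real root splits off an eigenvector.
\<close>

lemma eigen_sum_if_annihilated:
  assumes "p \<noteq> 0" "v \<in> carrier_vec n" "poly_app H p v = 0\<^sub>v n"
  shows "eigen_sum v"
  using assms
proof (induction "degree p" arbitrary: p v rule: less_induct)
  case less
  note v = \<open>v \<in> carrier_vec n\<close>
  note car = poly_app_carrier[OF H v]
  show ?case
  proof (cases "degree p = 0")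
    case True
    then obtain a where p: "p = [:a:]" "a \<noteq> 0"
      using less.prems(1) by (metis degree_eq_zeroE pCons_0_0)
    \<comment> \<open>A nonzero constant annihilates only the zero vector, which is the empty
      eigenvector sum.\<close>
    have "a * v $ i = 0" if "i < n" for i
      using arg_cong[OF less.prems(3), of "\<lambda>x. x $ i"] that v by (simp add: p poly_app_const[OF H])
    then show ?thesis
      unfolding eigen_sum_def using p by (intro exI[of _ "{}"]) auto
  next
    case False
    define cp where "cp = map_poly complex_of_real p"
    have "degree cp \<noteq> 0"
      using False by (simp add: cp_def degree_map_poly)
    then obtain \<alpha> where \<alpha>: "poly cp \<alpha> = 0"
      using fundamental_theorem_of_algebra[of cp] by (auto simp: constant_degree)
    show ?thesis
    proof (cases "Im \<alpha> = 0")
      case True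
      define a where "a = Re \<alpha>"
      have "\<alpha> = of_real a"
        using True by (simp add: a_def complex_eq_iff)
      then have "poly p a = 0"
        using \<alpha> poly_map_poly_of_real[of p a] by (simp add: cp_def)
      then obtain r where p: "p = [:- a, 1:] * r"
        by (auto simp: poly_eq_0_iff_dvd)
      with less.prems(1) have "r \<noteq> 0"
        by auto
      with degree_mult_eq[of "[:- a, 1:]" r] p have r: "r \<noteq> 0" "degree r < degree p"
        by auto
      define y where "y = poly_app H r v"
      have y: "y \<in> carrier_vec n"
        by (simp add: y_def car)
      have y0: "poly_app H [:- a, 1:] y = 0\<^sub>v n"
        using less.prems(3) unfolding p y_def by (simp only: poly_app_mult[OF H v])
      show ?thesis
      proof (cases "poly r a = 0")
        case True
        then obtain s where s: "r = [:- a, 1:] * s"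
          by (auto simp: poly_eq_0_iff_dvd)
        \<comment> \<open>For a double root, \<open>y\<close> is in the range of
          \<open>H - a\<close> and in its kernel. By symmetry \<open>y\<close> is orthogonal to
          itself, so \<open>r\<close> already annihilates \<open>v\<close>.\<close>
        have "y = poly_app H [:- a, 1:] (poly_app H s v)"
          unfolding y_def s by (rule poly_app_mult[OF H v])
        then have "y \<bullet> y = poly_app H s v \<bullet> poly_app H [:- a, 1:] y"
          using poly_app_linear_factor_symmetric[OF car y] by simp
        then have "y = 0\<^sub>v n"
          using y y0 car by (intro scalar_prod_self_eq_0D) auto
        then show ?thesis
          using less.hyps[OF r(2,1) v] by (simp add: y_def)
      next
        case False
        have ev: "H *\<^sub>v y = a \<cdot>\<^sub>v y"
        proof (rule eq_vecI)
          fix i assume "i < dim_vec (a \<cdot>\<^sub>v y)"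
          then show "(H *\<^sub>v y) $ i = (a \<cdot>\<^sub>v y) $ i"
            using arg_cong[OF y0, of "\<lambda>x. x $ i"] y H
            by (simp add: poly_app_linear_factor del: index_mult_mat_vec)
        qed (use H y in auto)
        \<comment> \<open>As \<open>y = r(H) v\<close> is an eigenvector for \<open>a\<close>,
          \<open>r(H) y\<close> equals \<open>r(a) y\<close>, and so \<open>r(H)\<close> annihilates
          \<open>r(a) v - y\<close>. The root is simple, hence \<open>v\<close> is recovered by
          dividing by \<open>r(a)\<close>.\<close>
        define v' where "v' = poly r a \<cdot>\<^sub>v v - y"
        have v': "v' \<in> carrier_vec n"
          using v y by (simp add: v'_def)
        have "poly_app H r v' = poly r a \<cdot>\<^sub>v y - poly r a \<cdot>\<^sub>v y"
          unfolding v'_def using poly_app_diff_smult_vec[OF H v y] poly_app_eigenvector[OF H y ev]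
          by (simp add: y_def)
        then have "eigen_sum v'"
          using less.hyps[OF r(2,1) v'] y by simp
        then obtain \<Lambda> w where "finite \<Lambda>" and w: "\<And>c. c \<in> \<Lambda> \<Longrightarrow> w c \<in> carrier_vec n"
          and wev: "\<And>c. c \<in> \<Lambda> \<Longrightarrow> H *\<^sub>v w c = c \<cdot>\<^sub>v w c"
          and "\<And>i. i < n \<Longrightarrow> v' $ i = (\<Sum>c\<in>\<Lambda>. w c $ i)"
          unfolding eigen_sum_def by blast
        then have "eigen_sum ((1 / poly r a) \<cdot>\<^sub>v v')"
          unfolding eigen_sum_def using v' H
          by (intro exI[of _ \<Lambda>] exI[of _ "\<lambda>c. (1 / poly r a) \<cdot>\<^sub>v w c"])
            (auto simp: mult_mat_vec[of _ n n] smult_smult_assoc mult.commute sum_divide_distrib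
              carrier_vecD[OF w] intro!: sum.cong)
        then show ?thesis
        proof (rule eigen_sum_add)
          show "H *\<^sub>v ((1 / poly r a) \<cdot>\<^sub>v y) = a \<cdot>\<^sub>v ((1 / poly r a) \<cdot>\<^sub>v y)"
            using H y ev by (simp add: mult_mat_vec[of _ n n] smult_smult_assoc mult.commute)
          show "v $ i = ((1 / poly r a) \<cdot>\<^sub>v v') $ i + ((1 / poly r a) \<cdot>\<^sub>v y) $ i" if "i < n" for i
            using that v y False by (simp add: v'_def field_simps)
        qed (use y in auto)
      qed
    next
      case False
      define a b where "a = Re \<alpha>" and "b = Im \<alpha>"
      \<comment> \<open>The real quadratic with roots \<open>\<alpha>\<close> and its conjugate,
        written as \<open>(X - a)^2 + b^2\<close> to suit the symmetry argument.\<close>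
      define q where "q = [:- a, 1:] * [:- a, 1:] + [:b\<^sup>2:]"
      have degq: "degree q = 2" "q \<noteq> 0"
        by (auto simp: q_def)
      have q\<alpha>: "poly (map_poly of_real q) \<alpha> = 0"
        by (simp add: q_def a_def b_def complex_eq_iff map_poly_pCons power2_eq_square algebra_simps)
      have "p mod q = 0"
      proof -
        \<comment> \<open>The remainder is a real linear polynomial \<open>e + f X\<close> vanishing
          at the non-real \<open>\<alpha>\<close>; imaginary and real part give \<open>f = 0\<close>
          and then \<open>e = 0\<close>.\<close>
        define s where "s = p mod q"
        have "degree s < 2"
          using degree_mod_less[OF degq(2), of p] degq(1) by (auto simp: s_def)
        then have "s = [:coeff s 0, coeff s 1:]"
          by (intro poly_eqI) (auto simp: coeff_pCons coeff_eq_0 split: nat.splits)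
        then obtain e f where s: "s = [:e, f:]"
          by blast
        have eq: "map_poly complex_of_real (q * (p div q) + s) = map_poly of_real p"
          by (simp add: s_def)
        have "poly (map_poly of_real s) \<alpha> = 0"
          using \<alpha> q\<alpha> arg_cong[OF eq, of "\<lambda>r. poly r \<alpha>"] unfolding cp_def by (simp add: map_poly_of_real_mult_add)
        then have "f * b = 0" "e + f * a = 0"
          by (simp_all add: s complex_eq_iff map_poly_pCons a_def b_def mult.commute)
        then show ?thesis
          using False unfolding s_def[symmetric] by (simp add: b_def s)
      qed
      define r where "r = p div q"
      have p: "p = q * r"
        using \<open>p mod q = 0\<close> by (simp add: r_def mod_0_imp_dvd)
      with less.prems(1) degq have r: "r \<noteq> 0" "degree r < degree p"
        by (auto simp: degree_mult_eq)
      define y where "y = poly_app H r v"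
      have y: "y \<in> carrier_vec n"
        by (simp add: y_def car)
      define x where "x = poly_app H [:- a, 1:] y"
      have x: "x \<in> carrier_vec n"
        unfolding x_def by (rule poly_app_carrier[OF H y])
      have "0\<^sub>v n = poly_app H q y"
        using less.prems(3) unfolding p y_def by (simp only: poly_app_mult[OF H v])
      also have "\<dots> = poly_app H [:- a, 1:] x + b\<^sup>2 \<cdot>\<^sub>v y"
        unfolding q_def x_def
        by (simp only: poly_app_add[OF H y] poly_app_mult[OF H y] poly_app_const[OF H y])
      \<comment> \<open>Pairing \<open>q(H) y = 0\<close> with \<open>y\<close> turns the square
        into the squared norm of \<open>x = (H - a) y\<close>, so two non-negative terms add up to
        zero and \<open>y\<close> vanishes.\<close>
      finally have "0 = (poly_app H [:- a, 1:] x + b\<^sup>2 \<cdot>\<^sub>v y) \<bullet> y"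
        using y by (metis scalar_prod_left_zero)
      also have "\<dots> = x \<bullet> x + b\<^sup>2 * (y \<bullet> y)"
        using poly_app_linear_factor_symmetric[OF x y] poly_app_carrier[OF H x] y
        by (simp add: add_scalar_prod_distrib[of _ n] x_def)
      finally have "b\<^sup>2 * (y \<bullet> y) = 0"
        using scalar_prod_self_nonneg[of x] scalar_prod_self_nonneg[of y]
        by (smt (verit) mult_nonneg_nonneg zero_le_power2)
      then have "y = 0\<^sub>v n"
        using False y by (intro scalar_prod_self_eq_0D) (auto simp: b_def)
      then show ?thesis
        using less.hyps[OF r(2,1) v] by (simp add: y_def)
    qed
  qed
qed

text \<open>The spectral theorem for one vector at a time. This suffices for norm estimates, so no
  eigenbasis has to be constructed.\<close>

lemma spectral_decomposition:
  assumes v: "v \<in> carrier_vec n"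
  obtains \<Lambda> w where "finite \<Lambda>" "\<And>c. c \<in> \<Lambda> \<Longrightarrow> w c \<in> carrier_vec n"
    "\<And>c. c \<in> \<Lambda> \<Longrightarrow> H *\<^sub>v w c = c \<cdot>\<^sub>v w c" "\<And>i. i < n \<Longrightarrow> v $ i = (\<Sum>c\<in>\<Lambda>. w c $ i)"
proof -
  obtain p where "p \<noteq> 0" "poly_app H p v = 0\<^sub>v n"
    using annihilating_poly_exists[OF H v] .
  then show ?thesis
    using eigen_sum_if_annihilated[OF _ v] that unfolding eigen_sum_def by metis
qed

lemma eigenvectors_orthogonal:
  assumes "x \<in> carrier_vec n" "y \<in> carrier_vec n" "H *\<^sub>v x = a \<cdot>\<^sub>v x" "H *\<^sub>v y = b \<cdot>\<^sub>v y" "a \<noteq> b"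
  shows "x \<bullet> y = 0"
proof -
  have "a * (x \<bullet> y) = b * (x \<bullet> y)"
    using symmetric_scalar_prod[OF H sym assms(1,2)] assms by simp
  then show ?thesis
    using assms(5) by simp
qed

text \<open>Pythagoras: mixed terms belong to different eigenvalues and vanish. The weights
  \<open>g\<close> will be values of scalar functions at the eigenvalues.\<close>

lemma scalar_prod_eigenvector_combination:
  assumes fin: "finite \<Lambda>" and w: "\<And>c. c \<in> \<Lambda> \<Longrightarrow> w c \<in> carrier_vec n"
    and ev: "\<And>c. c \<in> \<Lambda> \<Longrightarrow> H *\<^sub>v w c = c \<cdot>\<^sub>v w c"
    and x: "x \<in> carrier_vec n" "\<And>i. i < n \<Longrightarrow> x $ i = (\<Sum>c\<in>\<Lambda>. g c * w c $ i)"
  shows "x \<bullet> x = (\<Sum>c\<in>\<Lambda>. (g c)\<^sup>2 * (w c \<bullet> w c))"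
proof -
  have "x \<bullet> x = (\<Sum>i<n. (\<Sum>c\<in>\<Lambda>. \<Sum>d\<in>\<Lambda>. g c * g d * (w c $ i * w d $ i)))"
    using x by (simp add: scalar_prod_def atLeast0LessThan sum_product mult_ac)
  also have "\<dots> = (\<Sum>c\<in>\<Lambda>. \<Sum>i<n. \<Sum>d\<in>\<Lambda>. g c * g d * (w c $ i * w d $ i))"
    by (rule sum.swap)
  also have "\<dots> = (\<Sum>c\<in>\<Lambda>. \<Sum>d\<in>\<Lambda>. \<Sum>i<n. g c * g d * (w c $ i * w d $ i))"
    by (intro sum.cong refl sum.swap)
  also have "\<dots> = (\<Sum>c\<in>\<Lambda>. \<Sum>d\<in>\<Lambda>. g c * g d * (w c \<bullet> w d))"
    using w by (intro sum.cong refl) (auto simp: scalar_prod_def atLeast0LessThan sum_distrib_left dest!: carrier_vecD[OF w])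
  also have "\<dots> = (\<Sum>c\<in>\<Lambda>. \<Sum>d\<in>\<Lambda>. if c = d then (g c)\<^sup>2 * (w c \<bullet> w c) else 0)"
    by (intro sum.cong refl) (auto simp: eigenvectors_orthogonal[OF w w ev ev] power2_eq_square)
  also have "\<dots> = (\<Sum>c\<in>\<Lambda>. (g c)\<^sup>2 * (w c \<bullet> w c))"
    using fin by (intro sum.cong refl) (simp add: sum.delta')
  finally show ?thesis .
qed

end

section \<open>The matrix function \<open>\<phi>\<^sub>1\<close>\<close>

text \<open>The Taylor series of \<open>phi1\<close>, with coefficients \<open>1 / (k + 1)!\<close>,
  at the matrix \<open>H\<close> and applied to \<open>v\<close>, summed entrywise. Convergence is
  obtained where the value is used.\<close>

definition phi1_app :: "real mat \<Rightarrow> real vec \<Rightarrow> real vec" where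
  "phi1_app H v = vec (dim_vec v) (\<lambda>i. \<Sum>k. ((H ^\<^sub>m k) *\<^sub>v v) $ i / fact (Suc k))"

lemma phi1_app_carrier: "v \<in> carrier_vec n \<Longrightarrow> phi1_app H v \<in> carrier_vec n"
  by (simp add: phi1_app_def)

lemma phi1_sums: "(\<lambda>k. z ^ k / fact (Suc k)) sums phi1 z"
proof (cases "z = 0")
  case True
  have "(\<lambda>k. z ^ k / fact (Suc k)) sums (\<Sum>k\<in>{0}. z ^ k / fact (Suc k))"
    using True by (intro sums_finite) auto
  then show ?thesis using True by (simp add: phi1_def)
next
  case False
  have "(\<lambda>k. z ^ k / fact k) sums exp z"
    using exp_converges[of z] by (simp add: divide_inverse mult.commute)
  then have "(\<lambda>k. z ^ Suc k / fact (Suc k)) sums (exp z - 1)"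
    by (subst sums_Suc_iff) simp
  then have "(\<lambda>k. z ^ Suc k / fact (Suc k) / z) sums ((exp z - 1) / z)"
    by (rule sums_divide)
  then show ?thesis using False by (simp add: phi1_def)
qed

lemma mat_exp_mult_vec_sums:
  assumes M: "M \<in> carrier_mat n n" and v: "v \<in> carrier_vec n" and i: "i < n"
  shows "(\<lambda>k. ((M ^\<^sub>m k) *\<^sub>v v) $ i / fact k) sums (mat_exp M *\<^sub>v v) $ i"
proof -
  have E: "mat_exp M \<in> carrier_mat n n"
    using M by (simp add: mat_exp_def)
  have "(\<lambda>k. (M ^\<^sub>m k) $$ (i, j) / fact k * v $ j) sums (mat_exp M $$ (i, j) * v $ j)" if "j < n" for j
    using summable_sums[OF summable_mat_exp[OF M i that]] M i that
    by (intro sums_mult2) (simp add: mat_exp_def)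
  then have "(\<lambda>k. \<Sum>j<n. (M ^\<^sub>m k) $$ (i, j) / fact k * v $ j) sums (\<Sum>j<n. mat_exp M $$ (i, j) * v $ j)"
    by (intro sums_sum) auto
  then show ?thesis
    unfolding index_mult_mat_vec_sum[OF E v i] index_mult_mat_vec_sum[OF pow_carrier_mat[OF M] v i]
    by (simp add: sum_divide_distrib)
qed

text \<open>Without its first term, the exponential series is \<open>c\<close> times the
  \<open>phi1\<close> series. The two matrices are linked only through \<open>pow\<close>, because
  \<open>M\<close> will be non-symmetric and agrees with \<open>H\<close> only on the iterates;
  \<open>c \<noteq> 0\<close> transfers convergence to the \<open>phi1\<close> series.\<close>

lemma mat_exp_mult_vec_eq_phi1_app:
  assumes M: "M \<in> carrier_mat n n" and v: "v \<in> carrier_vec n"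
    and H: "H \<in> carrier_mat n n" and u: "u \<in> carrier_vec n"
    and pow: "\<And>k. (M ^\<^sub>m Suc k) *\<^sub>v v = c \<cdot>\<^sub>v ((H ^\<^sub>m k) *\<^sub>v u)" and c: "c \<noteq> 0"
  shows "mat_exp M *\<^sub>v v = v + c \<cdot>\<^sub>v phi1_app H u"
proof (rule eq_vecI)
  fix i assume "i < dim_vec (v + c \<cdot>\<^sub>v phi1_app H u)"
  then have i: "i < n"
    using u by (simp add: phi1_app_def)
  have "(\<lambda>k. ((M ^\<^sub>m Suc k) *\<^sub>v v) $ i / fact (Suc k)) sums ((mat_exp M *\<^sub>v v) $ i - v $ i)"
    using mat_exp_mult_vec_sums[OF M v i] M v i by (subst sums_Suc_iff) simp
  moreover have "((M ^\<^sub>m Suc k) *\<^sub>v v) $ i = c * ((H ^\<^sub>m k) *\<^sub>v u) $ i" for k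
    using H i unfolding pow by (subst index_smult_vec) (auto simp: pow_mat_dim_square)
  ultimately have "(\<lambda>k. c * ((H ^\<^sub>m k) *\<^sub>v u) $ i / fact (Suc k)) sums ((mat_exp M *\<^sub>v v) $ i - v $ i)"
    by (simp del: pow_mat.simps fact_Suc index_mult_mat_vec)
  then have "(\<lambda>k. c * ((H ^\<^sub>m k) *\<^sub>v u) $ i / fact (Suc k) / c) sums (((mat_exp M *\<^sub>v v) $ i - v $ i) / c)"
    by (rule sums_divide)
  then have "(\<lambda>k. ((H ^\<^sub>m k) *\<^sub>v u) $ i / fact (Suc k)) sums (((mat_exp M *\<^sub>v v) $ i - v $ i) / c)"
    using c by (simp del: fact_Suc index_mult_mat_vec)
  then show "(mat_exp M *\<^sub>v v) $ i = (v + c \<cdot>\<^sub>v phi1_app H u) $ i"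
    using u v i c by (simp add: phi1_app_def sums_unique[symmetric])
qed (use M u in \<open>simp add: phi1_app_def mat_exp_def\<close>)

text \<open>A general \<open>M\<close> with eigenvalues \<open>g c\<close> covers both
  \<open>H\<close> itself and its powers.\<close>

lemma mult_mat_eigenvector_sum:
  fixes M :: "real mat"
  assumes "finite \<Lambda>" and "\<And>c. c \<in> \<Lambda> \<Longrightarrow> w c \<in> carrier_vec n"
    and "M \<in> carrier_mat n n" and "\<And>c. c \<in> \<Lambda> \<Longrightarrow> M *\<^sub>v w c = g c \<cdot>\<^sub>v w c"
    and v: "v \<in> carrier_vec n" "\<And>i. i < n \<Longrightarrow> v $ i = (\<Sum>c\<in>\<Lambda>. h c * w c $ i)" and i: "i < n"
  shows "(M *\<^sub>v v) $ i = (\<Sum>c\<in>\<Lambda>. g c * h c * w c $ i)"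
proof -
  have "(M *\<^sub>v v) $ i = (\<Sum>j<n. \<Sum>c\<in>\<Lambda>. h c * (M $$ (i, j) * w c $ j))"
    unfolding index_mult_mat_vec_sum[OF assms(3) v(1) i] using v(2)
    by (auto simp: sum_distrib_left mult.left_commute intro!: sum.cong)
  also have "\<dots> = (\<Sum>c\<in>\<Lambda>. \<Sum>j<n. h c * (M $$ (i, j) * w c $ j))"
    by (rule sum.swap)
  also have "\<dots> = (\<Sum>c\<in>\<Lambda>. h c * (M *\<^sub>v w c) $ i)"
    by (intro sum.cong refl)
      (simp add: index_mult_mat_vec_sum[OF assms(3) assms(2) i] sum_distrib_left del: index_mult_mat_vec)
  also have "\<dots> = (\<Sum>c\<in>\<Lambda>. g c * h c * w c $ i)"
    using i by (intro sum.cong refl)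
      (simp add: assms(4) carrier_vecD[OF assms(2)] mult_ac del: index_mult_mat_vec)
  finally show ?thesis .
qed

lemma poly_app_eigenvector_sum:
  assumes H: "H \<in> carrier_mat n n" and fin: "finite \<Lambda>" and w: "\<And>c. c \<in> \<Lambda> \<Longrightarrow> w c \<in> carrier_vec n"
    and ev: "\<And>c. c \<in> \<Lambda> \<Longrightarrow> H *\<^sub>v w c = c \<cdot>\<^sub>v w c"
    and v: "v \<in> carrier_vec n" "\<And>i. i < n \<Longrightarrow> v $ i = (\<Sum>c\<in>\<Lambda>. w c $ i)" and i: "i < n"
  shows "poly_app H p v $ i = (\<Sum>c\<in>\<Lambda>. poly p c * w c $ i)"
  using i
proof (induction p arbitrary: i)
  case 0
  then show ?case using v by (simp add: poly_app_0[OF H])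
next
  case (pCons a p)
  have "(H *\<^sub>v poly_app H p v) $ i = (\<Sum>c\<in>\<Lambda>. c * poly p c * w c $ i)"
    using pCons by (intro mult_mat_eigenvector_sum[OF fin w H ev]) (auto intro: poly_app_carrier[OF H v(1)])
  then show ?case
    using v H pCons.prems
    by (simp add: poly_app_pCons[OF H] sum_distrib_left sum.distrib algebra_simps del: index_mult_mat_vec)
qed

text \<open>
  Expanding \<open>q\<close> into orthogonal eigenvectors reduces the claim to the scalar estimate at the
  eigenvalues, which are non-positive.
\<close>

lemma phi1_app_rational_error:
  fixes H :: "real mat" and n :: nat
  assumes H: "H \<in> carrier_mat n n" and sym: "transpose_mat H = H"
    and nsd: "\<And>x. x \<in> carrier_vec n \<Longrightarrow> x \<bullet> (H *\<^sub>v x) \<le> 0"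
    and q: "q \<in> carrier_vec n" and u: "u = poly_app H ([:\<gamma>, -1:] ^ d) q"
    and \<gamma>: "\<gamma> > 0" and e: "\<And>z. z \<le> 0 \<Longrightarrow> \<bar>phi1 z - poly p z / (\<gamma> - z) ^ d\<bar> \<le> e"
  shows "eucl_norm (phi1_app H u - poly_app H p q) \<le> e * eucl_norm u"
proof -
  obtain \<Lambda> w where fin: "finite \<Lambda>" and w: "\<And>c. c \<in> \<Lambda> \<Longrightarrow> w c \<in> carrier_vec n"
    and ev: "\<And>c. c \<in> \<Lambda> \<Longrightarrow> H *\<^sub>v w c = c \<cdot>\<^sub>v w c"
    and qsum: "\<And>i. i < n \<Longrightarrow> q $ i = (\<Sum>c\<in>\<Lambda>. w c $ i)"
    using spectral_decomposition[OF H sym q] by blast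
  \<comment> \<open>The components of \<open>u\<close> are those of \<open>q\<close> times
    \<open>P c\<close>. Expanding \<open>q\<close> instead of \<open>u\<close> means that nothing
    has to be inverted.\<close>
  define P where "P c = (\<gamma> - c) ^ d" for c
  have uc: "u \<in> carrier_vec n"
    unfolding u by (rule poly_app_carrier[OF H q])
  have usum: "u $ i = (\<Sum>c\<in>\<Lambda>. P c * w c $ i)" if "i < n" for i
    unfolding u using poly_app_eigenvector_sum[OF H fin w ev q qsum that] by (simp add: P_def)
  have phi: "phi1_app H u $ i = (\<Sum>c\<in>\<Lambda>. phi1 c * P c * w c $ i)" if i: "i < n" for i
  proof -
    have "((H ^\<^sub>m k) *\<^sub>v u) $ i = (\<Sum>c\<in>\<Lambda>. c ^ k * P c * w c $ i)" for k
      using H i uc usum by (intro mult_mat_eigenvector_sum[OF fin w])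
        (auto simp: pow_carrier_mat intro!: pow_mat_mult_eigenvector ev w)
    then have "((H ^\<^sub>m k) *\<^sub>v u) $ i / fact (Suc k) = (\<Sum>c\<in>\<Lambda>. c ^ k / fact (Suc k) * (P c * w c $ i))" for k
      by (simp add: sum_divide_distrib mult_ac del: fact_Suc index_mult_mat_vec)
    moreover have "(\<lambda>k. \<Sum>c\<in>\<Lambda>. c ^ k / fact (Suc k) * (P c * w c $ i)) sums (\<Sum>c\<in>\<Lambda>. phi1 c * (P c * w c $ i))"
      by (intro sums_sum sums_mult2 phi1_sums)
    ultimately have "(\<lambda>k. ((H ^\<^sub>m k) *\<^sub>v u) $ i / fact (Suc k)) sums (\<Sum>c\<in>\<Lambda>. phi1 c * (P c * w c $ i))"
      by (simp del: fact_Suc index_mult_mat_vec)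
    then show ?thesis
      using uc i by (simp add: phi1_app_def sums_unique[symmetric] mult.assoc)
  qed
  define x where "x = phi1_app H u - poly_app H p q"
  have xc: "x \<in> carrier_vec n"
    using phi1_app_carrier[OF uc] poly_app_carrier[OF H q] by (simp add: x_def)
  have "x $ i = (\<Sum>c\<in>\<Lambda>. (phi1 c * P c - poly p c) * w c $ i)" if "i < n" for i
    using that phi[OF that] poly_app_eigenvector_sum[OF H fin w ev q qsum that, of p]
      carrier_vecD[OF poly_app_carrier[OF H q]]
    by (simp add: x_def sum_subtractf left_diff_distrib)
  then have "x \<bullet> x = (\<Sum>c\<in>\<Lambda>. (phi1 c * P c - poly p c)\<^sup>2 * (w c \<bullet> w c))"
    by (intro scalar_prod_eigenvector_combination[OF H sym fin w ev xc])
  also have "\<dots> \<le> (\<Sum>c\<in>\<Lambda>. e\<^sup>2 * ((P c)\<^sup>2 * (w c \<bullet> w c)))"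
  proof (rule sum_mono)
    fix c assume c: "c \<in> \<Lambda>"
    show "(phi1 c * P c - poly p c)\<^sup>2 * (w c \<bullet> w c) \<le> e\<^sup>2 * ((P c)\<^sup>2 * (w c \<bullet> w c))"
    \<comment> \<open>Only a nonzero \<open>w c\<close> makes \<open>c\<close> a true eigenvalue,
      hence non-positive by \<open>nsd\<close>; a zero \<open>w c\<close> contributes nothing to
      either side.\<close>
    proof (cases "w c \<bullet> w c = 0")
      case False
      then have pos: "w c \<bullet> w c > 0"
        using scalar_prod_self_nonneg[of "w c"] by simp
      have "c * (w c \<bullet> w c) \<le> 0"
        using nsd[OF w[OF c]] ev[OF c] w[OF c] by simp
      then have c0: "c \<le> 0"
        using pos by (simp add: mult_le_0_iff)
      then have P: "P c > 0"
        using \<gamma> by (simp add: P_def)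
      have "\<bar>phi1 c * P c - poly p c\<bar> = \<bar>phi1 c - poly p c / P c\<bar> * P c"
        using P by (simp add: abs_mult_pos left_diff_distrib)
      also have "\<dots> \<le> e * P c"
        using e[OF c0] P by (intro mult_right_mono) (auto simp: P_def)
      finally have "(phi1 c * P c - poly p c)\<^sup>2 \<le> (e * P c)\<^sup>2"
        by (simp add: abs_le_square_iff[symmetric])
      then have "(phi1 c * P c - poly p c)\<^sup>2 * (w c \<bullet> w c) \<le> (e * P c)\<^sup>2 * (w c \<bullet> w c)"
        using pos by (intro mult_right_mono) auto
      then show ?thesis by (simp add: power_mult_distrib mult.assoc)
    qed simp
  qed
  also have "\<dots> = e\<^sup>2 * (u \<bullet> u)"
    using scalar_prod_eigenvector_combination[OF H sym fin w ev uc usum] by (simp add: sum_distrib_left)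
  also have "\<dots> = (e * eucl_norm u)\<^sup>2"
    by (simp add: power_mult_distrib eucl_norm_def scalar_prod_self_nonneg)
  finally have "x \<bullet> x \<le> (e * eucl_norm u)\<^sup>2" .
  moreover have "e \<ge> 0"
    using e[of 0] by linarith
  ultimately show ?thesis
    unfolding x_def[symmetric] by (subst eucl_norm_le_iff) (auto simp: eucl_norm_nonneg)
qed

section \<open>Existence of a best approximation\<close>

lemma Bseq_convergent_subseq:
  fixes X :: "nat \<Rightarrow> real"
  assumes "Bseq X"
  obtains r l where "strict_mono (r :: nat \<Rightarrow> nat)" "(\<lambda>k. X (r k)) \<longlonglongrightarrow> l"
proof -
  obtain r where r: "strict_mono r" "monoseq (\<lambda>k. X (r k))"
    using seq_monosub[of X] by blast
  have "Bseq (\<lambda>k. X (r k))"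
    using Bseq_subseq[OF assms] .
  then have "convergent (\<lambda>k. X (r k))"
    using r by (intro Bseq_monoseq_convergent)
  then show ?thesis
    using r that by (auto simp: convergent_def)
qed

text \<open>Compactness by induction on the degree: choose a subsequence converging at some
  \<open>a\<close> in \<open>S\<close>, subtract the value there and divide by \<open>X - a\<close>.
  The quotients have smaller degree and are bounded at each point of \<open>S - {a}\<close>. An
  infinite \<open>S\<close> never runs out of points.\<close>

lemma poly_pointwise_convergent_subseq:
  fixes p :: "nat \<Rightarrow> real poly"
  assumes "infinite S" "\<And>k. degree (p k) \<le> d" "\<And>x. x \<in> S \<Longrightarrow> Bseq (\<lambda>k. poly (p k) x)"
  shows "\<exists>r q. strict_mono (r :: nat \<Rightarrow> nat) \<and> degree q \<le> d \<and> (\<forall>x. (\<lambda>k. poly (p (r k)) x) \<longlonglongrightarrow> poly q x)"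
  using assms
proof (induction d arbitrary: p S)
  case 0
  obtain a where a: "a \<in> S"
    using 0(1) by (metis finite.emptyI ex_in_conv)
  obtain r l where r: "strict_mono r" "(\<lambda>k. poly (p (r k)) a) \<longlonglongrightarrow> l"
    using Bseq_convergent_subseq[OF 0(3)[OF a]] by blast
  have "poly (p k) x = poly (p k) a" for k x
    using 0(2)[of k] by (auto elim!: degree_eq_zeroE)
  then have "(\<lambda>k. poly (p (r k)) x) = (\<lambda>k. poly (p (r k)) a)" for x
    by blast
  then have "(\<lambda>k. poly (p (r k)) x) \<longlonglongrightarrow> l" for x
    using r(2) by metis
  then show ?case
    using r by (intro exI[of _ r] exI[of _ "[:l:]"]) auto
next
  case (Suc d)
  obtain a where a: "a \<in> S"
    using Suc.prems(1) by (metis finite.emptyI ex_in_conv)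
  obtain r1 l where r1: "strict_mono r1" "(\<lambda>k. poly (p (r1 k)) a) \<longlonglongrightarrow> l"
    using Bseq_convergent_subseq[OF Suc.prems(3)[OF a]] by blast
  define s where "s k = synthetic_div (p k) a" for k
  have p: "poly (p k) x = (x - a) * poly (s k) x + poly (p k) a" for k x
    using arg_cong[OF synthetic_div_correct'[of a "p k"], of "\<lambda>q. poly q x"]
    by (simp add: s_def algebra_simps)
  have "Bseq (\<lambda>k. poly (s (r1 k)) x)" if "x \<in> S - {a}" for x
  proof -
    obtain K1 where K1: "\<And>k. \<bar>poly (p k) x\<bar> \<le> K1"
      using Suc.prems(3)[of x] \<open>x \<in> S - {a}\<close> by (auto simp: Bseq_def)
    obtain K2 where K2: "\<And>k. \<bar>poly (p k) a\<bar> \<le> K2"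
      using Suc.prems(3)[OF a] by (auto simp: Bseq_def)
    show ?thesis
    proof (rule BseqI'[where K = "(K1 + K2) / \<bar>x - a\<bar>"])
      fix k
      have "\<bar>x - a\<bar> * \<bar>poly (s (r1 k)) x\<bar> = \<bar>poly (p (r1 k)) x - poly (p (r1 k)) a\<bar>"
        by (simp add: p[of _ x] abs_mult)
      also have "\<dots> \<le> K1 + K2"
        using K1[of "r1 k"] K2[of "r1 k"] by linarith
      finally show "norm (poly (s (r1 k)) x) \<le> (K1 + K2) / \<bar>x - a\<bar>"
        using that by (simp add: field_simps)
    qed
  qed
  moreover have "degree (s (r1 k)) \<le> d" for k
    using Suc.prems(2)[of "r1 k"] by (simp add: s_def degree_synthetic_div)
  moreover have "infinite (S - {a})"
    using Suc.prems(1) by simp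
  ultimately obtain r2 q where r2: "strict_mono r2" "degree q \<le> d"
    and q: "\<And>x. (\<lambda>k. poly (s (r1 (r2 k))) x) \<longlonglongrightarrow> poly q x"
    using Suc.IH[of "S - {a}" "\<lambda>k. s (r1 k)"] by blast
  have "(\<lambda>k. poly (p (r1 (r2 k))) x) \<longlonglongrightarrow> (x - a) * poly q x + l" for x
    unfolding p[of _ x] using q LIMSEQ_subseq_LIMSEQ[OF r1(2) r2(1)]
    by (intro tendsto_intros) (auto simp: o_def)
  moreover have "degree ([:- a, 1:] * q + [:l:]) \<le> Suc d"
    using degree_mult_le[of "[:- a, 1:]" q] r2(2) by (intro degree_add_le) auto
  ultimately show ?case
    using strict_mono_o[OF r1(1) r2(1), unfolded o_def]
    by (intro exI[of _ "\<lambda>k. r1 (r2 k)"] exI[of _ "[:- a, 1:] * q + [:l:]"]) (auto simp: algebra_simps)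
qed

lemma rat_error_le_sup_error:
  assumes "\<gamma> > 0" "r \<in> rat_funs \<gamma> d" "z \<le> 0"
  shows "\<bar>phi1 z - r z\<bar> \<le> sup_error r"
  unfolding sup_error_def using bdd_above_error[OF assms(1,2)] assms(3) by (intro cSUP_upper) auto

text \<open>The infimum is a minimum: along a minimising sequence the numerators are bounded at
  every \<open>z \<le> 0\<close>, so a subsequence converges pointwise to a polynomial of admissible
  degree, and the error bound at each \<open>z\<close> passes to the limit.\<close>

lemma best_error_attained:
  assumes \<gamma>: "\<gamma> > 0"
  obtains r where "r \<in> rat_funs \<gamma> (m - 2)" "sup_error r = best_error \<gamma> m"
proof -
  define d where "d = m - 2"
  define E where "E = best_error \<gamma> m"
  define R where "R p = (\<lambda>z. poly p z / (\<gamma> - z) ^ d)" for p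
  have R: "R p \<in> rat_funs \<gamma> d" if "degree p \<le> d" for p
    using that by (auto simp: R_def rat_funs_def)
  have "sup_error r \<ge> 0" if "r \<in> rat_funs \<gamma> d" for r
    using rat_error_le_sup_error[OF \<gamma> that, of 0] by linarith
  then have bdd: "bdd_below (sup_error ` rat_funs \<gamma> d)"
    by (intro bdd_belowI[of _ 0]) auto
  have ne: "sup_error ` rat_funs \<gamma> d \<noteq> {}"
    using R[of 0] by auto
  have "\<exists>p. degree p \<le> d \<and> sup_error (R p) < E + 1 / real (Suc k)" for k
  proof -
    have "Inf (sup_error ` rat_funs \<gamma> d) < E + 1 / real (Suc k)"
      by (simp add: E_def best_error_def d_def)
    then show ?thesis
      using cInf_lessD[OF ne] by (auto simp: R_def rat_funs_def)
  qed
  then obtain p where p: "\<And>k. degree (p k) \<le> d" "\<And>k. sup_error (R (p k)) < E + 1 / real (Suc k)"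
    by metis
  have err: "\<bar>phi1 z - R (p k) z\<bar> \<le> E + 1 / real (Suc k)" if "z \<le> 0" for z k
    using rat_error_le_sup_error[OF \<gamma> R[OF p(1)] that, of k] p(2)[of k] by linarith
  have "Bseq (\<lambda>k. poly (p k) z)" if z: "z \<in> {..0}" for z
  proof (rule BseqI')
    fix k
    have pos: "(\<gamma> - z) ^ d > 0"
      using z \<gamma> by simp
    have "1 / real (Suc k) \<le> 1" "z \<le> 0"
      using z by auto
    then have "\<bar>R (p k) z\<bar> \<le> \<bar>phi1 z\<bar> + E + 1"
      using err[OF \<open>z \<le> 0\<close>, of k] by linarith
    then show "norm (poly (p k) z) \<le> (\<bar>phi1 z\<bar> + E + 1) * (\<gamma> - z) ^ d"
      using pos by (simp add: R_def abs_divide pos_divide_le_eq)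
  qed
  moreover have "infinite {..0::real}"
    by (rule infinite_Iic)
  ultimately obtain r q where r: "strict_mono r" "degree q \<le> d"
    and q: "\<And>z. (\<lambda>k. poly (p (r k)) z) \<longlonglongrightarrow> poly q z"
    using poly_pointwise_convergent_subseq[of "{..0}" p d] p(1) by blast
  have "\<bar>phi1 z - R q z\<bar> \<le> E" if z: "z \<le> 0" for z
  proof (rule LIMSEQ_le)
    show "(\<lambda>k. \<bar>phi1 z - R (p (r k)) z\<bar>) \<longlonglongrightarrow> \<bar>phi1 z - R q z\<bar>"
      unfolding R_def using z \<gamma> by (intro tendsto_intros q) auto
    have "(\<lambda>k. E + 1 / real (Suc k)) \<longlonglongrightarrow> E + 0"
      by (intro tendsto_intros LIMSEQ_Suc lim_1_over_n)
    from LIMSEQ_subseq_LIMSEQ[OF this r(1)]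
    show "(\<lambda>k. E + 1 / real (Suc (r k))) \<longlonglongrightarrow> E"
      by (simp add: o_def)
    show "\<exists>N. \<forall>k\<ge>N. \<bar>phi1 z - R (p (r k)) z\<bar> \<le> E + 1 / real (Suc (r k))"
      using err[OF z] by blast
  qed
  then have "sup_error (R q) \<le> E"
    unfolding sup_error_def by (intro cSUP_least) auto
  moreover have "E \<le> sup_error (R q)"
    unfolding E_def best_error_def d_def[symmetric] using bdd R[OF r(2)] by (intro cINF_lower)
  ultimately show ?thesis
    using that[of "R q"] R[OF r(2)] by (simp add: d_def E_def)
qed


section \<open>Galerkin approximation in a rational Krylov space\<close>

text \<open>\<open>H\<close> is itself a polynomial in \<open>H\<close>, and multiplication of
  polynomials commutes.\<close>

lemma poly_app_mult_mat_vec: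
  assumes H: "H \<in> carrier_mat n n" and v: "v \<in> carrier_vec n"
  shows "H *\<^sub>v poly_app H p v = poly_app H p (H *\<^sub>v v)"
proof -
  have X: "poly_app H [:0, 1:] w = H *\<^sub>v w" if w: "w \<in> carrier_vec n" for w
  proof -
    have "poly_app H [:0, 1:] w = 0 \<cdot>\<^sub>v w + H *\<^sub>v w"
      using w by (simp add: poly_app_pCons[OF H] poly_app_0[OF H] mult_mat_zero_vec[OF H])
    also have "\<dots> = H *\<^sub>v w"
      using H w by (intro eq_vecI) auto
    finally show ?thesis .
  qed
  show ?thesis
    using X[OF poly_app_carrier[OF H v]] X[OF v]
    by (metis poly_app_mult[OF H v] mult.commute)
qed

text \<open>
  The vector \<open>x k\<close> stands for \<open>(\<gamma> - H)\<^sup>-\<^sup>k x\<^sub>0\<close>. Since \<open>x k\<close> lies in the range of \<open>V\<close> for \<open>k \<le> d\<close>,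
  the compression \<open>T\<close> reproduces \<open>p(H) (\<gamma> - H)\<^sup>-\<^sup>d x\<^sub>0\<close> exactly, so the error of \<open>\<phi>\<^sub>1\<close> is the error of
  \<open>\<phi>\<^sub>1 - r\<close>, once for \<open>H\<close> and once for \<open>T\<close>.
\<close>

lemma rational_krylov_phi1_error:
  fixes H V T :: "real mat" and x :: "nat \<Rightarrow> real vec"
  assumes H: "H \<in> carrier_mat n n" and sym: "transpose_mat H = H"
    and nsd: "\<And>v. v \<in> carrier_vec n \<Longrightarrow> v \<bullet> (H *\<^sub>v v) \<le> 0"
    and V: "V \<in> carrier_mat n m"
    and orth: "\<And>y. y \<in> carrier_vec m \<Longrightarrow> transpose_mat V *\<^sub>v (V *\<^sub>v y) = y"
    and T: "T = transpose_mat V * H * V"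
    and x: "\<And>k. k \<le> d \<Longrightarrow> x k \<in> carrier_vec n"
    and xV: "\<And>k. k \<le> d \<Longrightarrow> V *\<^sub>v (transpose_mat V *\<^sub>v x k) = x k"
    and Hx: "\<And>k. k < d \<Longrightarrow> H *\<^sub>v x (Suc k) = \<gamma> \<cdot>\<^sub>v x (Suc k) - x k"
    and \<gamma>: "\<gamma> > 0" and p: "degree p \<le> d"
    and e: "\<And>z. z \<le> 0 \<Longrightarrow> \<bar>phi1 z - poly p z / (\<gamma> - z) ^ d\<bar> \<le> e"
  shows "eucl_norm (phi1_app H (x 0) - V *\<^sub>v phi1_app T (transpose_mat V *\<^sub>v x 0)) \<le> 2 * e * eucl_norm (x 0)"
proof -
  let ?W = "transpose_mat V"
  define q where "q = x d"
  define P where "P = [:\<gamma>, -1:] ^ d"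
  define y where "y = ?W *\<^sub>v x 0"
  have q: "q \<in> carrier_vec n"
    by (simp add: q_def x)
  have W: "?W \<in> carrier_mat m n"
    using V by simp
  have Tc: "T \<in> carrier_mat m m"
    using V H W by (auto simp: T)
  have T_mult: "T *\<^sub>v v = ?W *\<^sub>v (H *\<^sub>v (V *\<^sub>v v))" if "v \<in> carrier_vec m" for v
    using that V H W by (simp add: T assoc_mult_mat_vec[of _ m n _ m] assoc_mult_mat_vec[of _ m n _ n])
  have range: "V *\<^sub>v (?W *\<^sub>v v) = v" if "y \<in> carrier_vec m" "v = V *\<^sub>v y" for v y
    using that orth by simp
  \<comment> \<open>In the Horner scheme, a factor \<open>H\<close> turns \<open>x k\<close> into
    \<open>\<gamma>\<close> times \<open>x k\<close> minus \<open>x (k - 1)\<close>, so degree and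
    index can be lowered together; a nonconstant polynomial forces \<open>k > 0\<close>.\<close>
  have mem: "V *\<^sub>v (?W *\<^sub>v poly_app H r (x k)) = poly_app H r (x k)" if "degree r \<le> k" "k \<le> d" for r k
    using that
  proof (induction r arbitrary: k)
    case 0
    then show ?case
      using x poly_app_0[OF H] mult_mat_zero_vec V W by (intro range[of "0\<^sub>v m"] eq_vecI) auto
  next
    case (pCons a r)
    have wc: "?W *\<^sub>v poly_app H r' (x j) \<in> carrier_vec m" if "j \<le> d" for j r'
      using W x[OF that] H by (intro mult_mat_vec_carrier[of _ m n] poly_app_carrier) auto
    have wx: "?W *\<^sub>v x j \<in> carrier_vec m" if "j \<le> d" for j
      using W x[OF that] by (intro mult_mat_vec_carrier[of _ m n])
    note xk = x[OF \<open>k \<le> d\<close>]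
    show ?case
    proof (cases "r = 0")
      case True
      show ?thesis
      proof (rule range)
        show "a \<cdot>\<^sub>v (?W *\<^sub>v x k) \<in> carrier_vec m"
          using wx[OF \<open>k \<le> d\<close>] by simp
        show "poly_app H (pCons a r) (x k) = V *\<^sub>v (a \<cdot>\<^sub>v (?W *\<^sub>v x k))"
          using True xk wx[OF \<open>k \<le> d\<close>] xV[OF \<open>k \<le> d\<close>] V
          by (simp add: poly_app_const[OF H] mult_mat_vec[of V n m])
      qed
    next
      case False
      then obtain k' where k: "k = Suc k'" "degree r \<le> k'" "k' < d"
        using pCons.prems by (cases k) auto
      have x': "x k' \<in> carrier_vec n"
        using k x by simp
      have "H *\<^sub>v poly_app H r (x k) = \<gamma> \<cdot>\<^sub>v poly_app H r (x k) - poly_app H r (x k')"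
        unfolding poly_app_mult_mat_vec[OF H xk] using Hx[OF k(3)] poly_app_diff_smult_vec[OF H xk x'] k(1) by simp
      then have eq: "poly_app H (pCons a r) (x k) =
          a \<cdot>\<^sub>v x k + (\<gamma> \<cdot>\<^sub>v poly_app H r (x k) - poly_app H r (x k'))"
        by (simp add: poly_app_pCons[OF H xk])
      have IH: "V *\<^sub>v (?W *\<^sub>v poly_app H r (x k)) = poly_app H r (x k)"
        "V *\<^sub>v (?W *\<^sub>v poly_app H r (x k')) = poly_app H r (x k')"
        using pCons.IH k pCons.prems by auto
      define w where "w = a \<cdot>\<^sub>v (?W *\<^sub>v x k) +
        (\<gamma> \<cdot>\<^sub>v (?W *\<^sub>v poly_app H r (x k)) - ?W *\<^sub>v poly_app H r (x k'))"
      have c: "?W *\<^sub>v x k \<in> carrier_vec m" "?W *\<^sub>v poly_app H r (x k) \<in> carrier_vec m"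
        "?W *\<^sub>v poly_app H r (x k') \<in> carrier_vec m"
        using wx wc k by auto
      show ?thesis
      proof (rule range)
        show "w \<in> carrier_vec m"
          using c by (simp add: w_def)
        show "poly_app H (pCons a r) (x k) = V *\<^sub>v w"
          unfolding w_def eq using c V IH xV[OF \<open>k \<le> d\<close>]
          by (subst mult_add_distrib_mat_vec[OF V] mult_minus_distrib_mat_vec[OF V]; simp add: mult_mat_vec[OF V])+
      qed
    qed
  qed
  \<comment> \<open>Multiplying by \<open>T\<close> inserts the projection \<open>V V^T\<close>
    before \<open>H\<close>, and by \<open>mem\<close> this projection fixes every intermediate
    Horner vector.\<close>
  have exact: "poly_app T r (?W *\<^sub>v q) = ?W *\<^sub>v poly_app H r q" if "degree r \<le> d" for r
    using that
  proof (induction r)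
    case 0
    then show ?case
      using poly_app_0[OF Tc, of "?W *\<^sub>v q"] poly_app_0[OF H q] W q by (intro eq_vecI) auto
  next
    case (pCons a r)
    have r: "degree r \<le> d"
      using pCons.prems by (cases "r = 0") auto
    define z where "z = poly_app H r q"
    have z: "z \<in> carrier_vec n"
      unfolding z_def by (rule poly_app_carrier[OF H q])
    have "T *\<^sub>v (?W *\<^sub>v z) = ?W *\<^sub>v (H *\<^sub>v z)"
      using mem[OF r order_refl] z W by (simp add: T_mult z_def q_def)
    moreover have "poly_app T r (?W *\<^sub>v q) = ?W *\<^sub>v z"
      using pCons.IH[OF r] by (simp add: z_def)
    ultimately have "poly_app T (pCons a r) (?W *\<^sub>v q) = a \<cdot>\<^sub>v (?W *\<^sub>v q) + ?W *\<^sub>v (H *\<^sub>v z)"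
      using poly_app_pCons[OF Tc, of "?W *\<^sub>v q" a r] W q by simp
    also have "\<dots> = ?W *\<^sub>v (a \<cdot>\<^sub>v q + H *\<^sub>v z)"
      using W q z H by (simp add: mult_add_distrib_mat_vec[OF W] mult_mat_vec[OF W])
    finally show ?case
      by (simp add: z_def poly_app_pCons[OF H q])
  qed
  have u: "x 0 = poly_app H ([:\<gamma>, -1:] ^ k) (x k)" if "k \<le> d" for k
    using that
  proof (induction k)
    case 0
    then show ?case
      using x[of 0] poly_app_const[OF H, of "x 0" 1] by (simp add: one_pCons)
  next
    case (Suc k)
    note c = x[OF Suc.prems] x[of k]
    have "poly_app H [:\<gamma>, -1:] (x (Suc k)) = \<gamma> \<cdot>\<^sub>v x (Suc k) + H *\<^sub>v (- 1 \<cdot>\<^sub>v x (Suc k))"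
      using c by (simp add: poly_app_pCons[OF H] poly_app_0[OF H] mult_mat_zero_vec[OF H])
    also have "\<dots> = \<gamma> \<cdot>\<^sub>v x (Suc k) + - 1 \<cdot>\<^sub>v (\<gamma> \<cdot>\<^sub>v x (Suc k) - x k)"
      using Hx[of k] c Suc.prems by (simp add: mult_mat_vec[OF H])
    also have "\<dots> = x k"
      using c Suc.prems by (intro eq_vecI) auto
    finally show ?case
      using Suc by (simp only: power_Suc2 poly_app_mult[OF H c(1)] Suc_leD)
  qed
  have norm_V: "eucl_norm (V *\<^sub>v v) = eucl_norm v" if "v \<in> carrier_vec m" for v
  proof -
    have "(V *\<^sub>v v) \<bullet> (V *\<^sub>v v) = (?W *\<^sub>v (V *\<^sub>v v)) \<bullet> v"
      using that V by (intro transpose_vec_mult_scalar[OF V, symmetric]) auto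
    then show ?thesis
      using orth[OF that] by (simp add: eucl_norm_def)
  qed
  have yc: "y \<in> carrier_vec m"
    using W x[of 0] by (simp add: y_def)
  have Vy: "V *\<^sub>v y = x 0"
    using xV[of 0] by (simp add: y_def)
  have "transpose_mat T = ?W * transpose_mat (?W * H)"
    unfolding T using V W H by (intro transpose_mult[of _ m n]) auto
  also have "transpose_mat (?W * H) = H * V"
    using transpose_mult[OF W H] sym by simp
  also have "?W * (H * V) = T"
    unfolding T using assoc_mult_mat[OF W H V] by simp
  finally have T_sym: "transpose_mat T = T" .
  have T_nsd: "v \<bullet> (T *\<^sub>v v) \<le> 0" if v: "v \<in> carrier_vec m" for v
  proof -
    have Vv: "V *\<^sub>v v \<in> carrier_vec n"
      using V v by simp
    have "v \<bullet> (T *\<^sub>v v) = (?W *\<^sub>v (H *\<^sub>v (V *\<^sub>v v))) \<bullet> v"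
      using v W H Vv by (simp add: T_mult comm_scalar_prod[of _ m])
    also have "\<dots> = (H *\<^sub>v (V *\<^sub>v v)) \<bullet> (V *\<^sub>v v)"
      using v H Vv by (intro transpose_vec_mult_scalar[OF V]) auto
    also have "\<dots> \<le> 0"
      using nsd[OF Vv] symmetric_scalar_prod[OF H sym Vv Vv] by simp
    finally show ?thesis .
  qed
  have "eucl_norm (phi1_app H (x 0) - poly_app H p q) \<le> e * eucl_norm (x 0)"
    by (rule phi1_app_rational_error[OF H sym nsd q _ \<gamma> e]) (simp_all add: q_def u[symmetric])
  moreover have "eucl_norm (phi1_app T y - poly_app T p (?W *\<^sub>v q)) \<le> e * eucl_norm y"
  proof (rule phi1_app_rational_error[OF Tc T_sym T_nsd _ _ \<gamma> e])
    show "?W *\<^sub>v q \<in> carrier_vec m"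
      using W q by simp
    \<comment> \<open>Exactness for the denominator polynomial shows that the projected
      \<open>q\<close> plays the role of \<open>q\<close> for \<open>T\<close>, so the same rational
      function serves both matrices.\<close>
    have "degree ([:\<gamma>, -1:] ^ d) \<le> d"
      by (simp add: degree_power_eq)
    then show "y = poly_app T ([:\<gamma>, -1:] ^ d) (?W *\<^sub>v q)"
      using exact u[of d] by (simp add: y_def q_def)
  qed
  moreover have "e * eucl_norm y = e * eucl_norm (x 0)"
    using norm_V[OF yc] Vy by simp
  moreover
  define z where "z = phi1_app T y - poly_app T p (?W *\<^sub>v q)"
  have c: "phi1_app T y \<in> carrier_vec m" "poly_app T p (?W *\<^sub>v q) \<in> carrier_vec m"
    using W q by (auto intro!: phi1_app_carrier yc poly_app_carrier[OF Tc])
  then have z: "z \<in> carrier_vec m"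
    by (simp add: z_def)
  have ch: "phi1_app H (x 0) \<in> carrier_vec n" "poly_app H p q \<in> carrier_vec n"
    by (auto intro!: phi1_app_carrier x poly_app_carrier[OF H q])
  \<comment> \<open>By \<open>exact\<close> and \<open>mem\<close> the rational part for
    \<open>T\<close> lifts to the one for \<open>H\<close>, so it cancels when the two errors are
    combined.\<close>
  have "V *\<^sub>v z = V *\<^sub>v phi1_app T y - poly_app H p q"
    unfolding z_def using c mem[OF p order_refl] exact[OF p]
    by (subst mult_minus_distrib_mat_vec[OF V]) (auto simp: q_def)
  then have "phi1_app H (x 0) - V *\<^sub>v phi1_app T y = (phi1_app H (x 0) - poly_app H p q) - V *\<^sub>v z"
    using ch c V by (intro eq_vecI) (auto simp del: index_mult_mat_vec)
  then have "eucl_norm (phi1_app H (x 0) - V *\<^sub>v phi1_app T y) \<le>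
      eucl_norm (phi1_app H (x 0) - poly_app H p q) + eucl_norm z"
    using eucl_norm_diff_le[of "phi1_app H (x 0) - poly_app H p q" n "V *\<^sub>v z"] ch z V norm_V[OF z] by simp
  ultimately show ?thesis
    unfolding z_def y_def by linarith
qed

section \<open>The inpainting matrix\<close>

definition zero_on :: "nat \<Rightarrow> nat set \<Rightarrow> real vec set" where
  "zero_on n K = {v \<in> carrier_vec n. \<forall>i<n. i \<in> K \<longrightarrow> v $ i = 0}"

lemma smult_zero_on: "v \<in> zero_on n K \<Longrightarrow> c \<cdot>\<^sub>v v \<in> zero_on n K"
  by (auto simp: zero_on_def)

text \<open>
  Zeroing the columns of stored pixels as well makes the matrix symmetric and does not change its
  action on vectors that vanish on \<open>K\<close>.
\<close>

definition interior_mat :: "nat \<Rightarrow> nat \<Rightarrow> nat set \<Rightarrow> real mat" where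
  "interior_mat Nx Ny K = mat (Nx * Ny) (Nx * Ny)
     (\<lambda>(i, j). if j \<in> K then 0 else inpainting_mat Nx Ny K $$ (i, j))"

lemma neighbour_sym: "neighbour Nx i j \<longleftrightarrow> neighbour Nx j i"
  by (auto simp: neighbour_def)

lemma neighbour_irrefl: "\<not> neighbour Nx i i"
  by (auto simp: neighbour_def)

context
  fixes Nx Ny n :: nat and K :: "nat set" and A :: "real mat"
  assumes n: "n = Nx * Ny" and A: "A = inpainting_mat Nx Ny K"
begin

lemma inpainting_mat_carrier: "A \<in> carrier_mat n n"
  by (simp add: A n inpainting_mat_def)

lemma inpainting_mat_index:
  "i < n \<Longrightarrow> j < n \<Longrightarrow> A $$ (i, j) = (if i \<in> K then 0
     else if i = j then - real (num_neighbours Nx Ny i) else if neighbour Nx i j then 1 else 0)"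
  by (simp add: A n inpainting_mat_def)

lemma inpainting_mat_mult_zero_on: "v \<in> carrier_vec n \<Longrightarrow> A *\<^sub>v v \<in> zero_on n K"
  using inpainting_mat_carrier
  by (auto simp: zero_on_def index_mult_mat_vec_sum inpainting_mat_index simp del: index_mult_mat_vec)

end

context
  fixes Nx Ny n :: nat and K :: "nat set" and H :: "real mat"
  assumes n: "n = Nx * Ny" and H: "H = interior_mat Nx Ny K"
begin

lemma interior_mat_carrier: "H \<in> carrier_mat n n"
  by (simp add: H n interior_mat_def)

lemma interior_mat_index:
  "i < n \<Longrightarrow> j < n \<Longrightarrow> H $$ (i, j) = (if j \<in> K then 0 else inpainting_mat Nx Ny K $$ (i, j))"
  by (simp add: H n interior_mat_def)

lemma interior_mat_symmetric: "transpose_mat H = H"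
  using interior_mat_carrier
  by (intro eq_matI) (auto simp: interior_mat_index inpainting_mat_index[OF n refl] neighbour_sym)

lemma interior_mat_mult_zero_on: "v \<in> carrier_vec n \<Longrightarrow> H *\<^sub>v v \<in> zero_on n K"
  using interior_mat_carrier
  by (auto simp: zero_on_def index_mult_mat_vec_sum interior_mat_index inpainting_mat_index[OF n refl]
      simp del: index_mult_mat_vec intro!: sum.neutral)

text \<open>
  With \<open>y\<close> the vector \<open>x\<close> cut off on \<open>K\<close>, the quadratic form is
  \<open>\<Sum> y\<^sub>i y\<^sub>j - y\<^sub>i\<^sup>2\<close> over neighbours \<open>i, j\<close>, which is symmetrised and then a sum of negative squares.
\<close>

lemma interior_mat_nonpos:
  assumes x: "x \<in> carrier_vec n"
  shows "x \<bullet> (H *\<^sub>v x) \<le> 0"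
proof -
  define y where "y i = (if i \<in> K then 0 else x $ i)" for i
  define N where "N i j = (if neighbour Nx i j then 1 else 0 :: real)" for i j
  have deg: "real (num_neighbours Nx Ny i) = (\<Sum>j<n. N i j)" for i
  proof -
    have "{j. j < Nx * Ny \<and> neighbour Nx i j} = {..<n} \<inter> {j. neighbour Nx i j}"
      by (auto simp: n)
    then show ?thesis
      by (simp add: num_neighbours_def N_def sum.If_cases)
  qed
  have "x \<bullet> (H *\<^sub>v x) = (\<Sum>i<n. x $ i * (\<Sum>j<n. H $$ (i, j) * x $ j))"
    using x interior_mat_carrier
    by (simp add: scalar_prod_def index_mult_mat_vec_sum atLeast0LessThan del: index_mult_mat_vec)
  also have "\<dots> = (\<Sum>i<n. \<Sum>j<n. N i j * (y i * y j - (y i)\<^sup>2))"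
  proof (intro sum.cong refl)
    fix i assume "i \<in> {..<n}"
    then have i: "i < n" by simp
    \<comment> \<open>No pixel is its own neighbour, so diagonal and neighbour terms do not overlap;
      stored rows and columns drop out because \<open>y\<close> is zero there.\<close>
    have "x $ i * H $$ (i, j) * x $ j =
        N i j * (y i * y j) - (if i = j then real (num_neighbours Nx Ny i) * (y i)\<^sup>2 else 0)" if "j < n" for j
      using i that
      by (auto simp: interior_mat_index inpainting_mat_index[OF n refl] N_def y_def neighbour_irrefl power2_eq_square)
    then have "x $ i * (\<Sum>j<n. H $$ (i, j) * x $ j) =
        (\<Sum>j<n. N i j * (y i * y j) - (if i = j then real (num_neighbours Nx Ny i) * (y i)\<^sup>2 else 0))"
      by (simp add: sum_distrib_left mult.assoc)
    also have "\<dots> = (\<Sum>j<n. N i j * (y i * y j)) - (\<Sum>j<n. N i j) * (y i)\<^sup>2"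
      using i by (simp add: sum_subtractf deg)
    also have "\<dots> = (\<Sum>j<n. N i j * (y i * y j - (y i)\<^sup>2))"
      by (simp add: sum_subtractf right_diff_distrib sum_distrib_right)
    finally show "x $ i * (\<Sum>j<n. H $$ (i, j) * x $ j) = (\<Sum>j<n. N i j * (y i * y j - (y i)\<^sup>2))" .
  qed
  finally have eq: "x \<bullet> (H *\<^sub>v x) = (\<Sum>i<n. \<Sum>j<n. N i j * (y i * y j - (y i)\<^sup>2))" .
  also have "\<dots> = (\<Sum>i<n. \<Sum>j<n. N i j * (y i * y j - (y j)\<^sup>2))"
    by (subst sum.swap) (simp add: N_def neighbour_sym mult.commute)
  finally have "2 * (x \<bullet> (H *\<^sub>v x)) =
      (\<Sum>i<n. \<Sum>j<n. N i j * (y i * y j - (y i)\<^sup>2)) + (\<Sum>i<n. \<Sum>j<n. N i j * (y i * y j - (y j)\<^sup>2))"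
    using eq by simp
  also have "\<dots> = (\<Sum>i<n. \<Sum>j<n. - (N i j * (y i - y j)\<^sup>2))"
    by (simp add: sum.distrib[symmetric] power2_eq_square algebra_simps)
  also have "\<dots> \<le> 0"
    by (intro sum_nonpos) (simp add: N_def)
  finally show ?thesis by simp
qed

end

lemma inpainting_mat_mult_eq_interior_mat_mult:
  assumes n: "n = Nx * Ny" and A: "A = inpainting_mat Nx Ny K" and H: "H = interior_mat Nx Ny K"
    and v_zero: "v \<in> zero_on n K"
  shows "A *\<^sub>v v = H *\<^sub>v v"
proof (rule eq_vecI)
  note carrier = inpainting_mat_carrier[OF n A] interior_mat_carrier[OF n H]
  fix i assume "i < dim_vec (H *\<^sub>v v)"
  then have i: "i < n"
    using carrier by simp
  have v: "v \<in> carrier_vec n"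
    using v_zero by (simp add: zero_on_def)
  show "(A *\<^sub>v v) $ i = (H *\<^sub>v v) $ i"
    unfolding index_mult_mat_vec_sum[OF carrier(1) v i] index_mult_mat_vec_sum[OF carrier(2) v i]
    using v_zero i by (intro sum.cong) (auto simp: interior_mat_index[OF n H] A zero_on_def)
qed (use inpainting_mat_carrier[OF n A] interior_mat_carrier[OF n H] in simp)

context
  fixes Nx Ny n :: nat and K :: "nat set" and \<gamma> t :: real and A M :: "real mat"
  assumes n: "n = Nx * Ny" and A: "A = inpainting_mat Nx Ny K" and M: "M = \<gamma> \<cdot>\<^sub>m 1\<^sub>m n - t \<cdot>\<^sub>m A"
begin

lemma shifted_mat_carrier: "M \<in> carrier_mat n n"
  using inpainting_mat_carrier[OF n A] by (auto simp: M)

lemma shifted_mat_mult: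
  assumes "v \<in> carrier_vec n"
  shows "M *\<^sub>v v = \<gamma> \<cdot>\<^sub>v v - t \<cdot>\<^sub>v (A *\<^sub>v v)"
  using assms inpainting_mat_carrier[OF n A] unfolding M
  by (subst minus_mult_distrib_mat_vec[of _ n n]) (auto simp: smult_mat_mult_vec[of _ n n])

lemma shifted_mat_mult_stored:
  assumes "v \<in> carrier_vec n" "i < n" "i \<in> K"
  shows "(M *\<^sub>v v) $ i = \<gamma> * v $ i"
  using assms inpainting_mat_mult_zero_on[OF n A assms(1)] inpainting_mat_carrier[OF n A]
  by (simp add: shifted_mat_mult zero_on_def del: index_mult_mat_vec)

text \<open>A kernel vector vanishes on \<open>K\<close>, where \<open>M\<close> is multiplication
  by \<open>\<gamma>\<close>. On such vectors \<open>A\<close> acts as the negative semidefinite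
  \<open>H\<close>, and testing with the vector itself shows that its squared norm is at most
  zero.\<close>

lemma shifted_mat_inverse:
  assumes \<gamma>: "\<gamma> > 0" and t: "t > 0"
  shows "mat_inv M \<in> carrier_mat n n" "M * mat_inv M = 1\<^sub>m n" "mat_inv M * M = 1\<^sub>m n"
proof -
  define H where "H = interior_mat Nx Ny K"
  have "v = 0\<^sub>v n" if v: "v \<in> carrier_vec n" and Mv: "M *\<^sub>v v = 0\<^sub>v n" for v
  proof -
    have "v $ i = 0" if "i < n" "i \<in> K" for i
      using shifted_mat_mult_stored[OF v that] Mv that \<gamma> by simp
    then have vz: "v \<in> zero_on n K"
      using v by (simp add: zero_on_def)
    have "0 = v \<bullet> (M *\<^sub>v v)"
      using v by (simp add: Mv)
    also have "\<dots> = \<gamma> * (v \<bullet> v) - t * (v \<bullet> (H *\<^sub>v v))"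
      unfolding shifted_mat_mult[OF v] inpainting_mat_mult_eq_interior_mat_mult[OF n A H_def vz]
      using v interior_mat_carrier[OF n H_def] by (subst scalar_prod_minus_distrib[of _ n]) auto
    finally have "\<gamma> * (v \<bullet> v) = t * (v \<bullet> (H *\<^sub>v v))" by simp
    also have "\<dots> \<le> 0"
      using interior_mat_nonpos[OF n H_def v] t by (simp add: mult_nonneg_nonpos)
    finally have "v \<bullet> v = 0"
      using \<gamma> scalar_prod_self_nonneg[of v] by (simp add: mult_le_0_iff)
    then show ?thesis
      using v by (intro scalar_prod_self_eq_0D)
  qed
  then have "det M \<noteq> 0"
    using shifted_mat_carrier by (auto simp: det_0_iff_vec_prod_zero[of M n])
  then have "M \<in> Units (ring_mat TYPE(real) n ())"
    using shifted_mat_carrier by (intro det_non_zero_imp_unit)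
  \<comment> \<open>\<open>mat_inverse\<close> yields \<open>None\<close> only for non-units, so
    \<open>mat_inv\<close> unwraps an actual inverse.\<close>
  then obtain B where "mat_inverse M = Some B"
    using mat_inverse(1)[OF shifted_mat_carrier, where b = "()"] by (cases "mat_inverse M") auto
  then show "mat_inv M \<in> carrier_mat n n" "M * mat_inv M = 1\<^sub>m n" "mat_inv M * M = 1\<^sub>m n"
    using mat_inverse(2)[OF shifted_mat_carrier] by (auto simp: mat_inv_def)
qed

text \<open>The inverse merely rescales stored entries, which keeps its powers applied to
  \<open>b\<close> proportional to \<open>b\<close> on \<open>K\<close>.\<close>

lemma mat_inv_mult_stored:
  assumes \<gamma>: "\<gamma> > 0" and t: "t > 0" and v: "v \<in> carrier_vec n" and i: "i < n" "i \<in> K"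
  shows "(mat_inv M *\<^sub>v v) $ i = v $ i / \<gamma>"
proof -
  have c: "mat_inv M *\<^sub>v v \<in> carrier_vec n"
    using shifted_mat_inverse(1)[OF \<gamma> t] v by simp
  have "M *\<^sub>v (mat_inv M *\<^sub>v v) = v"
    using assoc_mult_mat_vec[OF shifted_mat_carrier shifted_mat_inverse(1)[OF \<gamma> t] v] shifted_mat_inverse(2)[OF \<gamma> t] v by simp
  then show ?thesis
    using shifted_mat_mult_stored[OF c i] \<gamma> by (simp add: field_simps)
qed

end

text \<open>Only entries in \<open>K\<close> are removed, and these are zero; this identifies the
  norm of \<open>b_sym\<close> with that of \<open>A b\<close>.\<close>

lemma eucl_norm_restriction:
  assumes v: "v \<in> zero_on n K"
  shows "eucl_norm (restriction_mat n K *\<^sub>v v) = eucl_norm v"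
proof -
  define xs where "xs = filter (\<lambda>i. i \<notin> K) [0..<n]"
  have vc: "v \<in> carrier_vec n"
    using v by (simp add: zero_on_def)
  have xs: "xs ! l < n" if "l < length xs" for l
    using nth_mem[OF that] by (auto simp: xs_def)
  have R: "(restriction_mat n K *\<^sub>v v) $ l = v $ (xs ! l)" if "l < length xs" for l
    using that vc xs[OF that] by (simp add: restriction_mat_def xs_def[symmetric])
  have dim: "dim_vec (restriction_mat n K *\<^sub>v v) = length xs"
    by (simp add: restriction_mat_def xs_def)
  have "(restriction_mat n K *\<^sub>v v) \<bullet> (restriction_mat n K *\<^sub>v v) = (\<Sum>l<length xs. (v $ (xs ! l))\<^sup>2)"
    unfolding scalar_prod_def dim by (simp add: R atLeast0LessThan power2_eq_square del: index_mult_mat_vec)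
  also have "\<dots> = (\<Sum>i\<in>set xs. (v $ i)\<^sup>2)"
    by (intro sum.reindex_bij_betw bij_betw_nth) (auto simp: xs_def)
  also have "\<dots> = (\<Sum>i<n. (v $ i)\<^sup>2)"
    using v by (intro sum.mono_neutral_left) (auto simp: xs_def zero_on_def)
  also have "\<dots> = v \<bullet> v"
    using vc by (simp add: scalar_prod_def power2_eq_square atLeast0LessThan)
  finally show ?thesis
    by (simp add: eucl_norm_def)
qed

section \<open>Krylov spaces of the inpainting matrix\<close>

text \<open>With orthonormal columns, \<open>V V^T\<close> is the projection onto the column space,
  so membership can be used as a fixed-point equation.\<close>

lemma span_cols_imp_range:
  assumes V: "V \<in> carrier_mat n m"
    and orth: "\<And>y. y \<in> carrier_vec m \<Longrightarrow> transpose_mat V *\<^sub>v (V *\<^sub>v y) = y"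
    and w: "w \<in> vec_span n (set (cols V))"
  shows "V *\<^sub>v (transpose_mat V *\<^sub>v w) = w"
proof -
  interpret vec_space "TYPE(real)" n .
  have "w \<in> col_space V"
    using w by (simp add: vec_span_def col_space_def)
  then obtain y where "y \<in> carrier_vec m" "V *\<^sub>v y = w"
    using V by (auto simp: col_space_eq)
  then show ?thesis
    using orth by auto
qed

lemma vec_span_generator:
  assumes "G \<subseteq> carrier_vec n" "g \<in> G"
  shows "g \<in> vec_span n G"
proof -
  interpret vec_space "TYPE(real)" n .
  show ?thesis
    using in_own_span[of G] assms by (auto simp: vec_span_def)
qed

text \<open>Being a multiple of \<open>b\<close> on \<open>K\<close> is a linear condition, hence
  inherited by the span; the factor depends on the vector.\<close>

lemma vec_span_proportional_on:
  assumes G: "G \<subseteq> carrier_vec n"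
    and proportional: "\<And>g. g \<in> G \<Longrightarrow> \<exists>c. \<forall>i<n. i \<in> K \<longrightarrow> g $ i = c * b $ i"
    and x: "x \<in> vec_span n G"
  shows "\<exists>c. \<forall>i<n. i \<in> K \<longrightarrow> x $ i = c * b $ i"
proof -
  interpret vec_space "TYPE(real)" n .
  obtain a F where F: "x = lincomb a F" "F \<subseteq> G"
    using in_spanE[of x G] x by (auto simp: vec_span_def)
  obtain c where c: "\<And>g i. g \<in> G \<Longrightarrow> i < n \<Longrightarrow> i \<in> K \<Longrightarrow> g $ i = c g * b $ i"
    using proportional by metis
  have "x $ i = (\<Sum>g\<in>F. a g * c g) * b $ i" if "i < n" "i \<in> K" for i
  proof -
    have "x $ i = (\<Sum>g\<in>F. a g * g $ i)"
      unfolding F(1) using F(2) G that by (intro lincomb_index) auto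
    also have "\<dots> = (\<Sum>g\<in>F. a g * c g * b $ i)"
      using F(2) that by (intro sum.cong refl) (auto simp: c)
    finally show ?thesis
      by (simp add: sum_distrib_right)
  qed
  then show ?thesis by blast
qed

theorem theorem2:
  fixes Nx Ny n m :: nat and K :: "nat set" and f :: "nat \<Rightarrow> real"
    and t \<gamma> :: real and A R S V :: "real mat" and b b_sym f_m :: "real vec"
    and W :: "real vec set"
  assumes "Nx \<ge> 1" and "Ny \<ge> 1" and "n = Nx * Ny"
    and "K \<subseteq> {..<n}"
    and "A = inpainting_mat Nx Ny K"
    and "b = stored_vec n K f"
    and "R = restriction_mat n K"
    and "b_sym = R *\<^sub>v (A *\<^sub>v b)"
    and "m \<ge> 2" and "t > 0" and "\<gamma> > 0"
    and "W = ext_krylov A (mat_inv (\<gamma> \<cdot>\<^sub>m 1\<^sub>m n - t \<cdot>\<^sub>m A)) b m"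
    and "subspace_dim n W = m"
    and "V \<in> carrier_mat n m"
    and "\<forall>i<m. \<forall>j<m. col V i \<bullet> col V j = (if i = j then 1 else 0)"
    and "vec_span n (set (cols V)) = W"
    and "col V 0 = (1 / eucl_norm b) \<cdot>\<^sub>v b"
    and "S = transpose_mat V * A * V"
    and "f_m = eucl_norm b \<cdot>\<^sub>v (V *\<^sub>v (mat_exp (t \<cdot>\<^sub>m S) *\<^sub>v unit_vec m 0))"
  shows "(\<exists>r\<in>rat_funs \<gamma> (m - 2). sup_error r = best_error \<gamma> m) \<and>
         eucl_norm (mat_exp (t \<cdot>\<^sub>m A) *\<^sub>v b - f_m) \<le> 2 * t * best_error \<gamma> m * eucl_norm b_sym"
proof -

  \<comment> \<open>Notation and orthonormality of the basis\<close>
  note n = assms(3) and A_def = assms(5) and t = \<open>t > 0\<close> and \<gamma> = \<open>\<gamma> > 0\<close> and m = \<open>m \<ge> 2\<close>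
  note V = \<open>V \<in> carrier_mat n m\<close> and cols_orth = assms(15) and col0 = assms(17)
  define H where "H = interior_mat Nx Ny K"
  define M where "M = \<gamma> \<cdot>\<^sub>m 1\<^sub>m n - t \<cdot>\<^sub>m A"
  define C where "C = mat_inv M"
  define u where "u = A *\<^sub>v b"
  define d where "d = m - 2"
  define tH where "tH = t \<cdot>\<^sub>m H"
  define \<beta> where "\<beta> = eucl_norm b"
  define E where "E = best_error \<gamma> m"
  let ?Vt = "transpose_mat V"
  define T where "T = ?Vt * tH * V"
  have A: "A \<in> carrier_mat n n"
    by (rule inpainting_mat_carrier[OF n A_def])
  have H: "H \<in> carrier_mat n n"
    by (rule interior_mat_carrier[OF n H_def])
  have tH: "tH \<in> carrier_mat n n"
    using H by (simp add: tH_def)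
  have tH_mult: "tH *\<^sub>v v = t \<cdot>\<^sub>v (H *\<^sub>v v)" if "v \<in> carrier_vec n" for v
    unfolding tH_def by (rule smult_mat_mult_vec[OF H that])
  have Vt: "?Vt \<in> carrier_mat m n"
    using V by simp
  have Mc: "M \<in> carrier_mat n n"
    by (rule shifted_mat_carrier[OF n A_def M_def])
  have C: "C \<in> carrier_mat n n" and MC: "M * C = 1\<^sub>m n" and CM: "C * M = 1\<^sub>m n"
    unfolding C_def by (rule shifted_mat_inverse[OF n A_def M_def \<gamma> t])+
  have C_stored: "(C *\<^sub>v v) $ i = v $ i / \<gamma>" if "v \<in> carrier_vec n" "i < n" "i \<in> K" for v i
    unfolding C_def by (rule mat_inv_mult_stored[OF n A_def M_def \<gamma> t that])
  have b: "b \<in> carrier_vec n" and b_off: "\<And>i. i < n \<Longrightarrow> i \<notin> K \<Longrightarrow> b $ i = 0"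
    by (auto simp: assms(6) stored_vec_def)
  have u: "u \<in> carrier_vec n" and u_zero: "u \<in> zero_on n K"
    using A b inpainting_mat_mult_zero_on[OF n A_def b] by (auto simp: u_def)
  have zero_on_carrier: "v \<in> carrier_vec n" if "v \<in> zero_on n K" for v
    using that by (simp add: zero_on_def)
  have b_zero_on: "b \<bullet> v = 0" if "v \<in> zero_on n K" for v
    using that b_off by (auto simp: scalar_prod_def zero_on_def intro!: sum.neutral)
  \<comment> \<open>Division by zero gives zero, so \<open>b = 0\<close> would make the first column
    zero instead of a unit vector.\<close>
  have \<beta>: "\<beta> \<noteq> 0"
  proof
    assume "\<beta> = 0"
    then have "col V 0 \<bullet> col V 0 = 0"
      using b by (simp add: col0 \<beta>_def)
    then show False
      using cols_orth m by simp
  qed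
  have \<beta>2: "b \<bullet> b = \<beta>\<^sup>2"
    by (simp add: \<beta>_def eucl_norm_def scalar_prod_self_nonneg)
  have Vt_V: "?Vt * V = 1\<^sub>m m"
    using V cols_orth by (intro eq_matI) auto
  have orth: "?Vt *\<^sub>v (V *\<^sub>v y) = y" if "y \<in> carrier_vec m" for y
    using assoc_mult_mat_vec[OF Vt V that] that by (simp add: Vt_V)
  have V_e0: "V *\<^sub>v unit_vec m 0 = (1 / \<beta>) \<cdot>\<^sub>v b"
  proof -
    have "V *\<^sub>v unit_vec m 0 = col V 0"
      using V m by (intro eq_vecI) auto
    then show ?thesis
      by (simp add: col0 \<beta>_def)
  qed

  \<comment> \<open>The Krylov space as the range of \<open>V\<close>\<close>
  define G where "G = {b, A *\<^sub>v b} \<union> (\<lambda>k. (C ^\<^sub>m k) *\<^sub>v b) ` {1..d}"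
  have Ckb: "(C ^\<^sub>m k) *\<^sub>v v \<in> carrier_vec n" if "v \<in> carrier_vec n" for k v
    using pow_carrier_mat[OF C] that by (rule mult_mat_vec_carrier)
  have G: "G \<subseteq> carrier_vec n"
    using b A Ckb by (auto simp: G_def)
  have W: "W = vec_span n G"
    using assms(12) b by (simp add: ext_krylov_def G_def C_def M_def d_def)
  have range_G: "V *\<^sub>v (?Vt *\<^sub>v g) = g" if "g \<in> G" for g
    using span_cols_imp_range[OF V orth] vec_span_generator[OF G that] assms(16) W by simp
  have range_Ckb: "V *\<^sub>v (?Vt *\<^sub>v ((C ^\<^sub>m k) *\<^sub>v b)) = (C ^\<^sub>m k) *\<^sub>v b" if "k \<le> d" for k
  proof (cases "k = 0")
    case True
    then show ?thesis using range_G[of b] b C by (simp add: G_def)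
  next
    case False
    then show ?thesis using that by (intro range_G) (auto simp: G_def)
  qed

  \<comment> \<open>Shifted inverse iterates of \<open>A b\<close>\<close>
  have M_mult: "M *\<^sub>v v = \<gamma> \<cdot>\<^sub>v v - t \<cdot>\<^sub>v (A *\<^sub>v v)" if "v \<in> carrier_vec n" for v
    by (rule shifted_mat_mult[OF n A_def M_def that])
  \<comment> \<open>Although \<open>C\<close> inverts the non-symmetric
    \<open>\<gamma> - t A\<close>, these vectors vanish on \<open>K\<close>, so they are also the
    iterates of the inverse of \<open>\<gamma> - t H\<close>.\<close>
  define x where "x k = (C ^\<^sub>m k) *\<^sub>v u" for k
  have xc: "x k \<in> carrier_vec n" for k
    unfolding x_def by (rule Ckb[OF u])
  have x0: "x 0 = u"
    using u C by (simp add: x_def)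
  have xSuc: "x (Suc k) = C *\<^sub>v x k" for k
    unfolding x_def by (rule pow_mat_mult_vec_Suc'[OF C u])
  have x_zero: "x k \<in> zero_on n K" for k
  proof (induction k)
    case 0
    then show ?case using u_zero by (simp add: x0)
  next
    case (Suc k)
    have "x (Suc k) $ i = x k $ i / \<gamma>" if "i < n" "i \<in> K" for i
      unfolding xSuc by (rule C_stored[OF xc that])
    then show ?case
      using Suc xc by (simp add: zero_on_def)
  qed
  have Hx: "tH *\<^sub>v x (Suc k) = \<gamma> \<cdot>\<^sub>v x (Suc k) - x k" for k
  proof -
    have "x k = M *\<^sub>v x (Suc k)"
      using assoc_mult_mat_vec[OF Mc C xc, of k] xc[of k] by (simp add: MC xSuc)
    also have "\<dots> = \<gamma> \<cdot>\<^sub>v x (Suc k) - tH *\<^sub>v x (Suc k)"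
      using M_mult[OF xc] inpainting_mat_mult_eq_interior_mat_mult[OF n A_def H_def x_zero]
        tH_mult[OF xc] by simp
    finally have eq: "x k = \<gamma> \<cdot>\<^sub>v x (Suc k) - tH *\<^sub>v x (Suc k)" .
    show ?thesis
      unfolding eq using xc[of "Suc k"] tH
      by (intro eq_vecI) (auto simp del: index_mult_mat_vec)
  qed
  have range_x: "V *\<^sub>v (?Vt *\<^sub>v x k) = x k" if "k \<le> d" for k
  proof (cases k)
    case 0
    then show ?thesis using range_G[of u] by (simp add: x0 G_def u_def)
  next
    case (Suc l)
    \<comment> \<open>Since \<open>C (\<gamma> b - t A b) = b\<close>, the vector \<open>x k\<close>
      is a combination of two consecutive generators \<open>C^k b\<close> and
      \<open>C^(k-1) b\<close>, both in the Krylov space for \<open>k \<le> d\<close>.\<close>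
    define v w where "v = (C ^\<^sub>m Suc l) *\<^sub>v b" and "w = (C ^\<^sub>m l) *\<^sub>v b"
    have vw: "v \<in> carrier_vec n" "w \<in> carrier_vec n"
      by (simp_all only: v_def w_def Ckb[OF b])
    have "C *\<^sub>v (M *\<^sub>v b) = b"
      using assoc_mult_mat_vec[OF C Mc b] b by (simp add: CM)
    then have "w = (C ^\<^sub>m Suc l) *\<^sub>v (M *\<^sub>v b)"
      unfolding w_def using Mc b by (subst pow_mat_mult_vec_Suc[OF C]) auto
    also have "\<dots> = \<gamma> \<cdot>\<^sub>v v - t \<cdot>\<^sub>v x k"
      unfolding M_mult[OF b] v_def x_def Suc u_def[symmetric]
      using pow_carrier_mat[OF C, of "Suc l"] b u
      by (simp add: mult_minus_distrib_mat_vec[of _ n n] mult_mat_vec[of _ n n] del: pow_mat.simps)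
    finally have w: "w = \<gamma> \<cdot>\<^sub>v v - t \<cdot>\<^sub>v x k" .
    have xk: "x k = (\<gamma> / t) \<cdot>\<^sub>v v - (1 / t) \<cdot>\<^sub>v w"
      unfolding w using vw xc[of k] t by (intro eq_vecI) (auto simp: field_simps)
    have "V *\<^sub>v (?Vt *\<^sub>v v) = v" "V *\<^sub>v (?Vt *\<^sub>v w) = w"
      using range_Ckb[of "Suc l"] range_Ckb[of l] that Suc by (auto simp: v_def w_def)
    then show ?thesis
      unfolding xk using vw V Vt
      by (simp add: mult_minus_distrib_mat_vec[OF Vt] mult_mat_vec[OF Vt]
          mult_minus_distrib_mat_vec[OF V] mult_mat_vec[OF V])
  qed

  \<comment> \<open>The basis on the stored pixels\<close>
  have cols_zero: "V $$ (i, j) = 0" if j: "0 < j" "j < m" and i: "i < n" "i \<in> K" for i j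
  proof -
    \<comment> \<open>The factors on \<open>K\<close> are 1 for \<open>b\<close>, 0 for
      \<open>A b\<close> and \<open>\<gamma>^(-k)\<close> for \<open>C^k b\<close>.\<close>
    have proportional: "\<exists>c. \<forall>i<n. i \<in> K \<longrightarrow> g $ i = c * b $ i" if "g \<in> G" for g
    proof -
      have "\<forall>i<n. i \<in> K \<longrightarrow> ((C ^\<^sub>m k) *\<^sub>v b) $ i = (1 / \<gamma>) ^ k * b $ i" for k
      proof (induction k)
        case 0
        then show ?case using b C by simp
      next
        case (Suc k)
        show ?case
        proof (intro allI impI)
          fix i assume i: "i < n" "i \<in> K"
          have "((C ^\<^sub>m Suc k) *\<^sub>v b) $ i = ((C ^\<^sub>m k) *\<^sub>v b) $ i / \<gamma>"
            unfolding pow_mat_mult_vec_Suc'[OF C b] by (rule C_stored[OF Ckb[OF b] i])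
          then show "((C ^\<^sub>m Suc k) *\<^sub>v b) $ i = (1 / \<gamma>) ^ Suc k * b $ i"
            using Suc i by simp
        qed
      qed
      moreover have "\<forall>i<n. i \<in> K \<longrightarrow> (A *\<^sub>v b) $ i = 0 * b $ i"
        using u_zero by (simp add: u_def zero_on_def del: index_mult_mat_vec)
      moreover have "\<forall>i<n. i \<in> K \<longrightarrow> b $ i = 1 * b $ i"
        by simp
      ultimately show ?thesis
        using that unfolding G_def by blast
    qed
    have "col V j \<in> W"
      using assms(16) vec_span_generator[of "set (cols V)" n "col V j"] cols_dim[of V] V j(2)
      by (auto simp: cols_def)
    then obtain c where c: "\<And>i. i < n \<Longrightarrow> i \<in> K \<Longrightarrow> col V j $ i = c * b $ i"
      using vec_span_proportional_on[OF G proportional] W by metis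
    have cj: "col V j \<in> carrier_vec n"
      using V by auto
    \<comment> \<open>As \<open>b\<close> vanishes off \<open>K\<close>, the product sees only
      stored pixels and equals \<open>c\<close> times the squared norm of \<open>b\<close>;
      orthogonality to the first column forces \<open>c = 0\<close>.\<close>
    have "b \<bullet> col V j = (\<Sum>i<n. b $ i * (c * b $ i))"
      unfolding scalar_prod_def carrier_vecD[OF cj] atLeast0LessThan
    proof (intro sum.cong refl)
      fix i assume "i \<in> {..<n}"
      then show "b $ i * col V j $ i = b $ i * (c * b $ i)"
        using b_off[of i] c[of i] by (cases "i \<in> K") auto
    qed
    also have "\<dots> = c * (b \<bullet> b)"
      using b by (simp add: scalar_prod_def atLeast0LessThan sum_distrib_left mult_ac)
    finally have "b \<bullet> col V j = c * \<beta>\<^sup>2"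
      by (simp add: \<beta>2)
    moreover have "b \<bullet> col V j = 0"
    proof -
      have "col V 0 \<bullet> col V j = 0"
        using cols_orth j m by simp
      then show ?thesis
        using \<beta> b cj by (simp add: col0 \<beta>_def)
    qed
    ultimately have "c = 0"
      using \<beta> by simp
    then show ?thesis
      using c[OF i] V i j by simp
  qed
  have V_zero_on: "V *\<^sub>v y \<in> zero_on n K" if y: "y \<in> carrier_vec m" "y $ 0 = 0" for y
  proof -
    have "(V *\<^sub>v y) $ i = 0" if i: "i < n" "i \<in> K" for i
      unfolding index_mult_mat_vec_sum[OF V y(1) i(1)]
    proof (intro sum.neutral ballI)
      fix j assume "j \<in> {..<m}"
      then show "V $$ (i, j) * y $ j = 0"
        using cols_zero[of j i] i y(2) by (cases "j = 0") auto
    qed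
    then show ?thesis
      using V y by (simp add: zero_on_def del: index_mult_mat_vec)
  qed
  \<comment> \<open>The first column is a multiple of \<open>b\<close>, whose support lies in
    \<open>K\<close>.\<close>
  have Vt_index0: "(?Vt *\<^sub>v v) $ 0 = 0" if "v \<in> zero_on n K" for v
  proof -
    have "(?Vt *\<^sub>v v) $ 0 = col V 0 \<bullet> v"
      using V m by simp
    also have "\<dots> = 0"
      using b_zero_on[OF that] b zero_on_carrier[OF that] by (simp add: col0)
    finally show ?thesis .
  qed

  \<comment> \<open>The exact solution in terms of \<open>phi1\<close>\<close>
  have tA_pow: "((t \<cdot>\<^sub>m A) ^\<^sub>m Suc k) *\<^sub>v b = t \<cdot>\<^sub>v ((tH ^\<^sub>m k) *\<^sub>v u)" for k
  proof -
    have tA: "t \<cdot>\<^sub>m A \<in> carrier_mat n n"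
      using A by simp
    \<comment> \<open>One application of \<open>A\<close> takes \<open>b\<close> to
      \<open>u\<close>, which vanishes on \<open>K\<close>. Later iterates keep this property, and
      on them \<open>A\<close> may be replaced by \<open>H\<close>.\<close>
    have pz: "(tH ^\<^sub>m k) *\<^sub>v u \<in> zero_on n K" for k
    proof (induction k)
      case 0
      then show ?case using u_zero u tH by simp
    next
      case (Suc k)
      have "H *\<^sub>v ((tH ^\<^sub>m k) *\<^sub>v u) \<in> zero_on n K"
        by (rule interior_mat_mult_zero_on[OF n H_def zero_on_carrier[OF Suc]])
      moreover have "(tH ^\<^sub>m Suc k) *\<^sub>v u = t \<cdot>\<^sub>v (H *\<^sub>v ((tH ^\<^sub>m k) *\<^sub>v u))"
        unfolding pow_mat_mult_vec_Suc'[OF tH u] by (rule tH_mult[OF zero_on_carrier[OF Suc]])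
      ultimately show ?case
        using smult_zero_on by metis
    qed
    show ?thesis
    proof (induction k)
      case 0
      then show ?case
        using tA u tH b A by (simp add: smult_mat_mult_vec[OF A b] u_def)
    next
      case (Suc k)
      note z = zero_on_carrier[OF pz, of k]
      have "((t \<cdot>\<^sub>m A) ^\<^sub>m Suc (Suc k)) *\<^sub>v b = (t \<cdot>\<^sub>m A) *\<^sub>v (t \<cdot>\<^sub>v ((tH ^\<^sub>m k) *\<^sub>v u))"
        unfolding pow_mat_mult_vec_Suc'[OF tA b, of "Suc k"] Suc ..
      also have "\<dots> = t \<cdot>\<^sub>v ((t \<cdot>\<^sub>m A) *\<^sub>v ((tH ^\<^sub>m k) *\<^sub>v u))"
        by (rule mult_mat_vec[OF tA z])
      also have "(t \<cdot>\<^sub>m A) *\<^sub>v ((tH ^\<^sub>m k) *\<^sub>v u) = t \<cdot>\<^sub>v (H *\<^sub>v ((tH ^\<^sub>m k) *\<^sub>v u))"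
        unfolding smult_mat_mult_vec[OF A z]
        using inpainting_mat_mult_eq_interior_mat_mult[OF n A_def H_def pz] by simp
      also have "\<dots> = (tH ^\<^sub>m Suc k) *\<^sub>v u"
        unfolding pow_mat_mult_vec_Suc'[OF tH u] tH_mult[OF z] ..
      finally show ?case .
    qed
  qed
  have exp_A: "mat_exp (t \<cdot>\<^sub>m A) *\<^sub>v b = b + t \<cdot>\<^sub>v phi1_app tH u"
    using A t tA_pow by (intro mat_exp_mult_vec_eq_phi1_app[OF _ b tH u]) auto

  \<comment> \<open>The projected exponential in terms of \<open>phi1\<close>\<close>
  define w where "w = ?Vt *\<^sub>v u"
  have w: "w \<in> carrier_vec m"
    using Vt u by (simp add: w_def)
  have T: "T \<in> carrier_mat m m"
    using Vt tH V by (auto simp: T_def)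
  have S: "S \<in> carrier_mat m m"
    using Vt A V by (auto simp: assms(18))
  have T_mult: "T *\<^sub>v y = ?Vt *\<^sub>v (tH *\<^sub>v (V *\<^sub>v y))" if "y \<in> carrier_vec m" for y
    using that V Vt tH
    by (simp add: T_def assoc_mult_mat_vec[of _ m n _ m] assoc_mult_mat_vec[of _ m n _ n])
  have S_mult: "(t \<cdot>\<^sub>m S) *\<^sub>v y = t \<cdot>\<^sub>v (?Vt *\<^sub>v (A *\<^sub>v (V *\<^sub>v y)))" if "y \<in> carrier_vec m" for y
    using that V Vt A smult_mat_mult_vec[OF S that]
    by (simp add: assms(18) assoc_mult_mat_vec[of _ m n _ m] assoc_mult_mat_vec[of _ m n _ n])
  have tS: "t \<cdot>\<^sub>m S \<in> carrier_mat m m"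
    using S by simp
  \<comment> \<open>Without a component along the first column, \<open>V y\<close> vanishes on
    \<open>K\<close>, and there the compressions of \<open>t A\<close> and \<open>t H\<close>
    agree.\<close>
  have tS_T: "(t \<cdot>\<^sub>m S) *\<^sub>v y = T *\<^sub>v y" if y: "y \<in> carrier_vec m" "y $ 0 = 0" for y
  proof -
    note z = V_zero_on[OF y]
    have "T *\<^sub>v y = ?Vt *\<^sub>v (t \<cdot>\<^sub>v (H *\<^sub>v (V *\<^sub>v y)))"
      unfolding T_mult[OF y(1)] tH_mult[OF zero_on_carrier[OF z]] ..
    then show ?thesis
      unfolding S_mult[OF y(1)] inpainting_mat_mult_eq_interior_mat_mult[OF n A_def H_def z]
      using mult_mat_vec[OF Vt] H zero_on_carrier[OF z] by simp
  qed
  have T_pow: "(T ^\<^sub>m k) *\<^sub>v w \<in> carrier_vec m \<and> ((T ^\<^sub>m k) *\<^sub>v w) $ 0 = 0" for k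
  proof (induction k)
    case 0
    then show ?case using w T Vt_index0[OF u_zero] by (simp add: w_def)
  next
    case (Suc k)
    let ?y = "(T ^\<^sub>m k) *\<^sub>v w"
    have Vy: "V *\<^sub>v ?y \<in> carrier_vec n"
      using V Suc by simp
    have "tH *\<^sub>v (V *\<^sub>v ?y) \<in> zero_on n K"
      using interior_mat_mult_zero_on[OF n H_def Vy] unfolding tH_mult[OF Vy]
      by (rule smult_zero_on)
    then show ?case
      unfolding pow_mat_mult_vec_Suc'[OF T w] using T_mult Vt_index0 Suc
      by (simp add: mult_mat_vec_carrier[OF Vt mult_mat_vec_carrier[OF tH Vy]])
  qed
  \<comment> \<open>The factor \<open>t / \<beta>\<close> stems from the first column
    \<open>b / \<beta>\<close>; after this first step all iterates have first entry zero by
    \<open>T_pow\<close>, so \<open>tS_T\<close> applies.\<close>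
  have tS_pow: "((t \<cdot>\<^sub>m S) ^\<^sub>m Suc k) *\<^sub>v unit_vec m 0 = (t / \<beta>) \<cdot>\<^sub>v ((T ^\<^sub>m k) *\<^sub>v w)" for k
  proof (induction k)
    case 0
    have "A *\<^sub>v ((1 / \<beta>) \<cdot>\<^sub>v b) = (1 / \<beta>) \<cdot>\<^sub>v u"
      by (simp add: mult_mat_vec[OF A b] u_def)
    then have "(t \<cdot>\<^sub>m S) *\<^sub>v unit_vec m 0 = (t / \<beta>) \<cdot>\<^sub>v w"
      using S_mult[of "unit_vec m 0"] V_e0 mult_mat_vec[OF Vt u, of "1 / \<beta>"]
      by (simp add: w_def smult_smult_assoc)
    then show ?case
      using tS T w by simp
  next
    case (Suc k)
    note y = T_pow[of k, THEN conjunct1] T_pow[of k, THEN conjunct2]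
    show ?case
      unfolding pow_mat_mult_vec_Suc'[OF tS unit_vec_carrier, of "Suc k"] Suc
        mult_mat_vec[OF tS y(1)] tS_T[OF y] pow_mat_mult_vec_Suc'[OF T w] ..
  qed
  have exp_S: "mat_exp (t \<cdot>\<^sub>m S) *\<^sub>v unit_vec m 0 = unit_vec m 0 + (t / \<beta>) \<cdot>\<^sub>v phi1_app T w"
    using t \<beta> tS_pow by (intro mat_exp_mult_vec_eq_phi1_app[OF tS _ T w]) auto

  \<comment> \<open>Comparison of the two representations\<close>
  have phiT: "phi1_app T w \<in> carrier_vec m"
    by (rule phi1_app_carrier[OF w])
  have phiH: "phi1_app tH u \<in> carrier_vec n"
    by (rule phi1_app_carrier[OF u])
  have "V *\<^sub>v (unit_vec m 0 + (t / \<beta>) \<cdot>\<^sub>v phi1_app T w) = (1 / \<beta>) \<cdot>\<^sub>v b + (t / \<beta>) \<cdot>\<^sub>v (V *\<^sub>v phi1_app T w)"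
    using phiT by (simp add: mult_add_distrib_mat_vec[OF V] mult_mat_vec[OF V] V_e0)
  then have f_m: "f_m = \<beta> \<cdot>\<^sub>v ((1 / \<beta>) \<cdot>\<^sub>v b + (t / \<beta>) \<cdot>\<^sub>v (V *\<^sub>v phi1_app T w))"
    unfolding assms(19) exp_S \<beta>_def by simp
  \<comment> \<open>Scaling by \<open>\<beta>\<close> turns the projected solution into
    \<open>b\<close> plus a correction; the vector \<open>b\<close> cancels and a factor
    \<open>t\<close> remains.\<close>
  have diff: "mat_exp (t \<cdot>\<^sub>m A) *\<^sub>v b - f_m = t \<cdot>\<^sub>v (phi1_app tH u - V *\<^sub>v phi1_app T w)"
    unfolding exp_A f_m using b V phiH phiT \<beta>
    by (intro eq_vecI) (auto simp: algebra_simps simp del: index_mult_mat_vec)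

  obtain r where r: "r \<in> rat_funs \<gamma> d" "sup_error r = E"
    using best_error_attained[OF \<gamma>, of m] by (auto simp: d_def E_def)
  obtain p where p: "degree p \<le> d" "r = (\<lambda>z. poly p z / (\<gamma> - z) ^ d)"
    using r(1) by (auto simp: rat_funs_def)
  have tH_sym: "transpose_mat tH = tH"
  proof -
    have "transpose_mat tH = t \<cdot>\<^sub>m transpose_mat H"
      by (intro eq_matI) (auto simp: tH_def)
    then show ?thesis
      using interior_mat_symmetric[OF n H_def] by (simp add: tH_def)
  qed
  have tH_nsd: "v \<bullet> (tH *\<^sub>v v) \<le> 0" if v: "v \<in> carrier_vec n" for v
    unfolding tH_mult[OF v]
    using interior_mat_nonpos[OF n H_def v] t H v by (simp add: mult_nonneg_nonpos)
  have "eucl_norm (phi1_app tH (x 0) - V *\<^sub>v phi1_app T (?Vt *\<^sub>v x 0)) \<le> 2 * E * eucl_norm (x 0)"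
  proof (rule rational_krylov_phi1_error[where x = x, OF tH tH_sym tH_nsd V orth T_def xc range_x Hx \<gamma> p(1)])
    show "\<bar>phi1 z - poly p z / (\<gamma> - z) ^ d\<bar> \<le> E" if "z \<le> 0" for z
      using rat_error_le_sup_error[OF \<gamma> r(1) that] r(2) p(2) by simp
  qed
  then have "eucl_norm (phi1_app tH u - V *\<^sub>v phi1_app T w) \<le> 2 * E * eucl_norm b_sym"
    using eucl_norm_restriction[OF u_zero] by (simp add: x0 w_def assms(7,8) u_def)
  then have "t * eucl_norm (phi1_app tH u - V *\<^sub>v phi1_app T w) \<le> t * (2 * E * eucl_norm b_sym)"
    using t by (intro mult_left_mono) auto
  then have "eucl_norm (mat_exp (t \<cdot>\<^sub>m A) *\<^sub>v b - f_m) \<le> 2 * t * E * eucl_norm b_sym"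
    unfolding diff eucl_norm_smult using t by (simp add: mult_ac)
  then show ?thesis
    using r by (auto simp: E_def d_def)
qed

end
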